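(* Let $\mu$ be a probability distribution on $\mathbb{R}^{n\times n}$ with bounded support and let $\mathcal M=\operatorname{supp}\mu$. Assume that (i) there is a proper cone $K\subset\mathbb{R}^n$ such that $AK\subset K$ for every $A\in\mathcal M$; and (ii) the singular part $\mu_s$ of $\mu$ with respect to Lebesgue measure on $\mathbb{R}^{n\times n}$ is either $0$ or of the form $\mu_s=p_1\delta_{M_1}+\cdots+p_N\delta_{M_N}$ for some finite $N$, positive numbers $p_1,\dots,p_N$ and matrices $M_1,\dots,M_N\in\mathbb{R}^{n\times n}$. Then $$\hat\rho(\mathcal M)=\lim_{p\to\infty}\rho_{p,\mu},$$ where the limit is over positive integers $p$.
   Context: A cone in $\mathbb{R}^n$ is a subset closed under multiplication by nonnegative numbers; it is proper if it is closed, convex, has nonempty interior, and is pointed ($x,-x\in K$ implies $x=0$). For a bounded set $\mathcal M\subset\mathbb{R}^{n\times n}$, the joint spectral radius is $\hat\rho(\mathcal M)=\limsup_{k\to\infty}\sup_{A_1,\dots,A_k\in\mathcal M}\|A_k\cdots A_1\|^{1/k}$. For a probability distribution $\mu$ on $\mathbb{R}^{n\times n}$ with bounded support and a positive integer $p$, the $L^p$-norm joint spectral radius ($p$-radius) of $\mu$ is $\rho_{p,\mu}=\lim_{k\to\infty}\left(E[\|A_k\cdots A_1\|^p]\right)^{1/(pk)}$, where $A_1,A_2,\dots$ are independent random matrices with distribution $\mu$ (the limit exists and is finite). Here $\|\cdot\|$ is the maximal singular value; both quantities are independent of the choice of matrix norm. $\delta_M$ denotes the Dirac measure at $M$. *)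

theory Defs
  imports "HOL-Probability.Probability"
begin

definition proper_cone :: "(real^'n) set \<Rightarrow> bool" where
  "proper_cone K \<longleftrightarrow> cone K \<and> closed K \<and> convex K \<and> interior K \<noteq> {}
     \<and> (\<forall>x. x \<in> K \<and> - x \<in> K \<longrightarrow> x = 0)"

definition singular_value :: "real^'n^'n \<Rightarrow> real \<Rightarrow> bool" where
  "singular_value A s \<longleftrightarrow> 0 \<le> s \<and> (\<exists>v. v \<noteq> 0 \<and> (transpose A ** A) *v v = s\<^sup>2 *\<^sub>R v)"

(* The library norm on real^'n^'n is the Frobenius norm, hence a separate constant. *)
definition max_singular_value :: "real^'n^'n \<Rightarrow> real" where
  "max_singular_value A = (GREATEST s. singular_value A s)"

primrec left_prod :: "(nat \<Rightarrow> real^'n^'n) \<Rightarrow> nat \<Rightarrow> real^'n^'n" where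
  "left_prod A 0 = mat 1"
| "left_prod A (Suc k) = A (Suc k) ** left_prod A k"

(* Values in ereal, so that supremum and limsup need no boundedness side conditions. *)
definition joint_spectral_radius :: "(real^'n^'n) set \<Rightarrow> ereal" where
  "joint_spectral_radius \<M> =
     limsup (\<lambda>k. SUP A \<in> {1..k} \<rightarrow> \<M>. ereal (root k (max_singular_value (left_prod A k))))"

(* A_1, ..., A_k are the coordinates of the k-fold product of mu with itself;
   expectation_iid below shows that any i.i.d. sequence gives the same value. *)
definition p_radius :: "nat \<Rightarrow> (real^'n^'n) measure \<Rightarrow> real" where
  "p_radius p \<mu> =
     lim (\<lambda>k. root (p * k)
       (\<integral>A. max_singular_value (left_prod A k) ^ p \<partial>(\<Pi>\<^sub>M i\<in>{1..k}. \<mu>)))"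

definition supp :: "'a::topological_space measure \<Rightarrow> 'a set" where
  "supp \<mu> = {x. \<forall>U. open U \<and> x \<in> U \<longrightarrow> emeasure \<mu> U > 0}"

definition mutually_singular :: "'a measure \<Rightarrow> 'a measure \<Rightarrow> bool" where
  "mutually_singular M N \<longleftrightarrow>
     (\<exists>S. S \<in> sets M \<and> S \<in> sets N \<and> emeasure N S = 0 \<and> emeasure M (space M - S) = 0)"

(* \<nu> is the singular summand of the Lebesgue decomposition of \<mu> with respect to M;
   for sigma-finite \<mu> and M it exists and is unique. *)
definition is_singular_part :: "'a measure \<Rightarrow> 'a measure \<Rightarrow> 'a measure \<Rightarrow> bool" where
  "is_singular_part M \<mu> \<nu> \<longleftrightarrow> sets \<nu> = sets M \<and> mutually_singular \<nu> M \<and>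
     (\<exists>\<alpha>. sets \<alpha> = sets M \<and> absolutely_continuous M \<alpha> \<and>
        (\<forall>B\<in>sets M. emeasure \<mu> B = emeasure \<alpha> B + emeasure \<nu> B))"

lemma singular_value_max_onorm:
  fixes A :: "real^'n^'n"
  shows "singular_value A (onorm ((*v) A))"
    and "singular_value A s \<Longrightarrow> s \<le> onorm ((*v) A)"
proof -
  let ?f = "(*v) A"
  have bl: "bounded_linear ?f" by (rule matrix_vector_mul_bounded_linear)
  have dot: "(A *v x) \<bullet> (A *v y) = ((transpose A ** A) *v x) \<bullet> y" for x y :: "real^'n"
    by (simp only: matrix_vector_mul_assoc[symmetric] transpose_matrix_vector dot_lmul_matrix)
  show "singular_value A s \<Longrightarrow> s \<le> onorm ?f"
  proof -
    assume "singular_value A s"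
    then obtain v where s: "0 \<le> s" and v: "v \<noteq> 0" "(transpose A ** A) *v v = s\<^sup>2 *\<^sub>R v"
      by (auto simp: singular_value_def)
    have "(norm (A *v v))\<^sup>2 = (s * norm v)\<^sup>2"
      using dot[of v v] v(2) by (simp add: power2_norm_eq_inner power_mult_distrib)
    then have "norm (A *v v) = s * norm v"
      using s by (simp add: power2_eq_iff_nonneg)
    moreover have "norm (A *v v) \<le> onorm ?f * norm v" by (rule onorm[OF bl])
    ultimately show ?thesis using v(1) by simp
  qed
  let ?S = "sphere (0::real^'n) 1"
  have "compact ?S" by simp
  moreover have ne: "?S \<noteq> {}" by simp
  moreover have "continuous_on ?S (\<lambda>x. norm (A *v x))"
    by (intro continuous_intros linear_continuous_on bl)
  ultimately obtain v where v: "norm v = 1" and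
    mx: "\<And>x. norm x = 1 \<Longrightarrow> norm (A *v x) \<le> norm (A *v v)"
    using continuous_attains_sup[of ?S "\<lambda>x. norm (A *v x)"] by auto
  define m where "m = norm (A *v v)"
  have le: "norm (A *v x) \<le> m * norm x" for x
  proof (cases "x = 0")
    case False
    then have "norm (A *v (inverse (norm x) *\<^sub>R x)) \<le> m"
      unfolding m_def by (intro mx) simp
    then show ?thesis using False
      by (simp add: matrix_vector_mult_scaleR field_simps)
  qed simp
  have on: "onorm ?f = m"
  proof (rule antisym)
    show "onorm ?f \<le> m" using le by (intro onorm_le) auto
    show "m \<le> onorm ?f" using onorm[OF bl, of v] v by (simp add: m_def)
  qed
  define w where "w = m\<^sup>2 *\<^sub>R v - (transpose A ** A) *v v"
  define q where "q x = m\<^sup>2 * (x \<bullet> x) - (A *v x) \<bullet> (A *v x)" for x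
  have q0: "q x \<ge> 0" for x
    using power_mono[OF le[of x] norm_ge_zero, of 2]
    by (simp add: q_def power2_norm_eq_inner[symmetric] power_mult_distrib)
  have qv: "q v = 0" using v by (simp add: q_def m_def power2_norm_eq_inner[symmetric])
  have qexp: "q (v + t *\<^sub>R w) = 2 * t * (w \<bullet> w) + t\<^sup>2 * q w" for t
  proof -
    have "w \<bullet> w = m\<^sup>2 * (v \<bullet> w) - (A *v v) \<bullet> (A *v w)"
      using dot[of v w] by (subst (1) w_def) (simp add: inner_diff_left)
    moreover have "q (v + t *\<^sub>R w) = q v + 2 * t * (m\<^sup>2 * (v \<bullet> w) - (A *v v) \<bullet> (A *v w)) + t\<^sup>2 * q w"
      unfolding q_def
      by (simp add: matrix_vector_right_distrib matrix_vector_mult_scaleR inner_add_left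
          inner_add_right inner_commute algebra_simps power2_eq_square)
    ultimately show ?thesis using qv by simp
  qed
  have "w = 0"
  proof (rule ccontr)
    assume "w \<noteq> 0"
    then have ww: "w \<bullet> w > 0" by simp
    define t where "t = - (w \<bullet> w) / (q w + 1)"
    have "t < 0" using ww q0[of w] by (simp add: t_def divide_neg_pos)
    moreover have "2 * (w \<bullet> w) + t * q w > 0"
    proof -
      have "- t * q w \<le> w \<bullet> w" using q0[of w] ww by (simp add: t_def field_simps)
      then show ?thesis using ww by linarith
    qed
    ultimately have "t * (2 * (w \<bullet> w) + t * q w) < 0" by (rule mult_neg_pos)
    then show False using q0[of "v + t *\<^sub>R w"] qexp[of t]
      by (simp add: algebra_simps power2_eq_square)
  qed
  then have "(transpose A ** A) *v v = m\<^sup>2 *\<^sub>R v" by (simp add: w_def)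
  then show "singular_value A (onorm ?f)"
    unfolding on singular_value_def using v by (intro conjI exI[of _ v]) (auto simp: m_def)
qed

lemma max_singular_value_eq_onorm: "max_singular_value A = onorm ((*v) A)"
  unfolding max_singular_value_def
  by (rule Greatest_equality) (auto intro: singular_value_max_onorm)

lemma continuous_max_singular_value:
  "continuous_on UNIV (max_singular_value :: real^'n^'n \<Rightarrow> real)"
proof -
  have sub: "onorm ((*v) A) - onorm ((*v) B) \<le> norm (A - B)" for A B :: "real^'n^'n"
  proof -
    have "onorm ((*v) A) = onorm (\<lambda>x. (A - B) *v x + B *v x)"
      by (simp add: matrix_vector_mult_diff_rdistrib)
    also have "\<dots> \<le> onorm ((*v) (A - B)) + onorm ((*v) B)"
      by (rule onorm_triangle) (rule matrix_vector_mul_bounded_linear)+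
    also have "onorm ((*v) (A - B)) \<le> norm (A - B)"
    proof (rule onorm_le)
      fix x :: "real^'n"
      have "norm ((A - B) *v x) = L2_set (\<lambda>i. \<bar>(A - B) $ i \<bullet> x\<bar>) UNIV"
        by (simp add: norm_vec_def matrix_mult_dot)
      also have "\<dots> \<le> L2_set (\<lambda>i. norm ((A - B) $ i) * norm x) UNIV"
        by (rule L2_set_mono) (auto intro: Cauchy_Schwarz_ineq2)
      also have "\<dots> = norm (A - B) * norm x"
        by (subst L2_set_left_distrib[symmetric]) (auto simp: norm_vec_def[of "A - B"])
      finally show "norm ((A - B) *v x) \<le> norm (A - B) * norm x" .
    qed
    finally show ?thesis by simp
  qed
  have "\<bar>onorm ((*v) A) - onorm ((*v) B)\<bar> \<le> dist A B" for A B :: "real^'n^'n"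
    using sub[of A B] sub[of B A] by (simp add: dist_norm norm_minus_commute)
  then show ?thesis
    unfolding continuous_on_iff max_singular_value_eq_onorm dist_real_def
    by (meson order.strict_trans1)
qed

lemma measurable_left_prod:
  assumes "j \<le> k"
  shows "(\<lambda>A. left_prod A j) \<in> (\<Pi>\<^sub>M i\<in>{1..k}. borel) \<rightarrow>\<^sub>M (borel :: (real^'n^'n) measure)"
  using assms
proof (induction j)
  case (Suc j)
  have *: "continuous_on UNIV (\<lambda>x::(real^'n^'n) \<times> (real^'n^'n). fst x ** snd x)"
    unfolding matrix_matrix_mult_def
    by (intro continuous_on_vec_lambda continuous_on_sum continuous_intros)
  have "(\<lambda>A. A (Suc j)) \<in> (\<Pi>\<^sub>M i\<in>{1..k}. borel) \<rightarrow>\<^sub>M (borel :: (real^'n^'n) measure)"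
    using Suc.prems by (intro measurable_component_singleton) auto
  moreover have "(\<lambda>A. left_prod A j) \<in> (\<Pi>\<^sub>M i\<in>{1..k}. borel) \<rightarrow>\<^sub>M (borel :: (real^'n^'n) measure)"
    using Suc by linarith
  ultimately have "(\<lambda>A. A (Suc j) ** left_prod A j) \<in> (\<Pi>\<^sub>M i\<in>{1..k}. borel) \<rightarrow>\<^sub>M (borel :: (real^'n^'n) measure)"
    by (rule borel_measurable_continuous_Pair[where H = "(**)"]) (rule *)
  then show ?case by simp
qed simp

lemma left_prod_cong: "(\<And>i. i \<in> {1..k} \<Longrightarrow> A i = B i) \<Longrightarrow> left_prod A k = left_prod B k"
  by (induction k) auto

lemma expectation_iid:
  fixes X :: "nat \<Rightarrow> 'w \<Rightarrow> real^'n^'n"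
  assumes "prob_space \<Omega>"
    and indep: "prob_space.indep_vars \<Omega> (\<lambda>_. borel) X {1..}"
    and law: "\<And>i. i \<ge> 1 \<Longrightarrow> distr \<Omega> borel (X i) = \<mu>"
  shows "(\<integral>\<omega>. max_singular_value (left_prod (\<lambda>i. X i \<omega>) k) ^ p \<partial>\<Omega>) =
    (\<integral>A. max_singular_value (left_prod A k) ^ p \<partial>(\<Pi>\<^sub>M i\<in>{1..k}. \<mu>))"
proof (cases "k = 0")
  case True
  interpret prob_space \<Omega> by fact
  interpret P: prob_space "\<Pi>\<^sub>M i\<in>{}. \<mu>" by (rule prob_space_PiM) simp
  show ?thesis using True by (simp add: prob_space P.prob_space)
next
  case False
  interpret prob_space \<Omega> by fact
  have rv: "random_variable borel (X i)" if "i \<in> {1..k}" for i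
    using indep that by (auto simp: indep_vars_def)
  have "indep_vars (\<lambda>_. borel) X {1..k}"
    using indep by (rule indep_vars_subset) auto
  then have "distr \<Omega> (\<Pi>\<^sub>M i\<in>{1..k}. borel) (\<lambda>x. \<lambda>i\<in>{1..k}. X i x) = (\<Pi>\<^sub>M i\<in>{1..k}. distr \<Omega> borel (X i))"
    using False rv by (subst (asm) indep_vars_iff_distr_eq_PiM') auto
  also have "\<dots> = (\<Pi>\<^sub>M i\<in>{1..k}. \<mu>)"
    by (rule PiM_cong) (auto simp: law)
  finally have d: "(\<Pi>\<^sub>M i\<in>{1..k}. \<mu>) = distr \<Omega> (\<Pi>\<^sub>M i\<in>{1..k}. borel) (\<lambda>x. \<lambda>i\<in>{1..k}. X i x)" ..
  have eq: "left_prod (\<lambda>i\<in>{1..k}. X i x) k = left_prod (\<lambda>i. X i x) k" for x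
    by (rule left_prod_cong) simp
  have "(\<lambda>A. max_singular_value (left_prod A k) ^ p) \<in> borel_measurable (\<Pi>\<^sub>M i\<in>{1..k}. borel)"
    by (intro borel_measurable_power measurable_compose[OF measurable_left_prod]
        borel_measurable_continuous_onI continuous_max_singular_value) simp
  then show ?thesis
    unfolding d using rv by (subst integral_distr) (auto simp only: eq intro!: measurable_restrict)
qed

end

theory Submission
  imports Defs
begin

text \<open>
  The inequality \<open>\<rho>\<^sub>p \<le> \<rho>\<close> is immediate. Conversely, suppose \<open>\<rho>\<^sub>p < r\<close> for infinitely many \<open>p\<close>.
  For such \<open>p\<close> the norm \<open>N\<^sub>p(X)\<^sup>p = \<Sum>\<^sub>k r\<^sup>-\<^sup>p\<^sup>k E \<parallel>A\<^sub>k \<dots> A\<^sub>1 X\<parallel>\<^sup>p\<close> on matrices satisfies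
  \<open>E N\<^sub>p(A X)\<^sup>p \<le> r\<^sup>p N\<^sub>p(X)\<^sup>p\<close>. If \<open>U\<close> is a neighbourhood of a point \<open>A\<close> of the support, some
  \<open>B \<in> U\<close> in the support therefore has \<open>N\<^sub>p(B X) \<le> \<mu>(U)\<^sup>-\<^sup>1\<^sup>/\<^sup>p r N\<^sub>p(X)\<close>, and \<open>\<mu>(U)\<^sup>-\<^sup>1\<^sup>/\<^sup>p\<close> tends to 1.
  So a limit \<open>N\<close> of the normalised \<open>N\<^sub>p\<close> satisfies \<open>N(A X) \<le> r N(X)\<close> for every \<open>A\<close> in the support.
  This limit may be degenerate, but its kernel is an invariant subspace, on which the argument can be
  repeated; by induction on the dimension, every \<open>s > r\<close> admits a norm with \<open>N(A X) \<le> s N(X)\<close>,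
  whence \<open>\<rho> \<le> s\<close>.
\<close>

subsection \<open>Contracting seminorms\<close>

text \<open>Relative to \<open>V\<close> because the induction on the dimension passes to invariant
  subspaces. Outside \<open>V\<close> nothing is prescribed.\<close>

definition seminorm_on :: "'a::euclidean_space set \<Rightarrow> ('a \<Rightarrow> real) \<Rightarrow> bool" where
  "seminorm_on V N \<longleftrightarrow> (\<forall>x\<in>V. 0 \<le> N x) \<and> (\<forall>x\<in>V. \<forall>y\<in>V. N (x + y) \<le> N x + N y)
     \<and> (\<forall>x\<in>V. \<forall>c. N (c *\<^sub>R x) = \<bar>c\<bar> * N x)"

lemma seminorm_onD:
  assumes "seminorm_on V N" "x \<in> V"
  shows "0 \<le> N x" "y \<in> V \<Longrightarrow> N (x + y) \<le> N x + N y" "N (c *\<^sub>R x) = \<bar>c\<bar> * N x" "N (- x) = N x"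
proof -
  show hom: "N (c *\<^sub>R x) = \<bar>c\<bar> * N x" for c using assms unfolding seminorm_on_def by blast
  show "N (- x) = N x" using hom[of "- 1"] by simp
qed (use assms in \<open>auto simp: seminorm_on_def\<close>)

lemma seminorm_on_subset: "seminorm_on V N \<Longrightarrow> W \<subseteq> V \<Longrightarrow> seminorm_on W N"
  unfolding seminorm_on_def by blast

lemma seminorm_on_0: "seminorm_on V N \<Longrightarrow> 0 \<in> V \<Longrightarrow> N 0 = 0"
  using seminorm_onD(3)[of V N 0 0] by simp

lemma seminorm_on_diff:
  "seminorm_on V N \<Longrightarrow> subspace V \<Longrightarrow> x \<in> V \<Longrightarrow> y \<in> V \<Longrightarrow> N (x - y) \<le> N x + N y"
  using seminorm_onD(2)[of V N x "- y"] seminorm_onD(4)[of V N y] by (simp add: subspace_neg)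

lemma seminorm_on_sum:
  assumes N: "seminorm_on V N" and V: "subspace V" and "finite B" and "\<And>b. b \<in> B \<Longrightarrow> f b \<in> V"
  shows "N (\<Sum>b\<in>B. f b) \<le> (\<Sum>b\<in>B. N (f b))"
  using assms(3,4)
proof (induction B rule: finite_induct)
  case empty
  then show ?case using seminorm_on_0[OF N] V by (simp add: subspace_0)
next
  case (insert b B)
  then have "(\<Sum>b\<in>B. f b) \<in> V" using V by (intro subspace_sum) auto
  then have "N (f b + (\<Sum>b\<in>B. f b)) \<le> N (f b) + N (\<Sum>b\<in>B. f b)"
    using insert.prems by (intro seminorm_onD(2)[OF N]) auto
  then show ?case using insert by fastforce
qed

section \<open>Seminorms compared with the Euclidean norm\<close>

text \<open>Expand \<open>x\<close> in the orthonormal basis and bound each coordinate by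
  \<open>norm x\<close>. The explicit constant matters: seminorms whose values on the basis sum to 1
  are dominated by the norm uniformly.\<close>

lemma seminorm_on_le_norm:
  assumes N: "seminorm_on V N" and V: "subspace V"
    and B: "B \<subseteq> V" "pairwise orthogonal B" "\<And>b. b \<in> B \<Longrightarrow> norm b = 1" "finite B" "span B = V"
    and x: "x \<in> V"
  shows "N x \<le> (\<Sum>b\<in>B. N b) * norm x"
proof -
  have "N x = N (\<Sum>b\<in>B. (x \<bullet> b) *\<^sub>R b)"
    using orthonormal_basis_expand[OF B(2,3) _ B(4), of x] x B(5) by simp
  also have "\<dots> \<le> (\<Sum>b\<in>B. N ((x \<bullet> b) *\<^sub>R b))"
    using B(1) V by (intro seminorm_on_sum[OF N V B(4)]) (auto intro: subspace_scale)
  also have "\<dots> \<le> (\<Sum>b\<in>B. N b * norm x)"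
  proof (rule sum_mono)
    fix b assume b: "b \<in> B"
    then have "\<bar>x \<bullet> b\<bar> \<le> norm x" using Cauchy_Schwarz_ineq2[of x b] B(3) by simp
    moreover have "N ((x \<bullet> b) *\<^sub>R b) = \<bar>x \<bullet> b\<bar> * N b" "0 \<le> N b"
      using seminorm_onD[OF N] b B(1) by auto
    ultimately show "N ((x \<bullet> b) *\<^sub>R b) \<le> N b * norm x"
      by (metis mult.commute mult_right_mono)
  qed
  finally show ?thesis by (simp add: sum_distrib_right)
qed

lemma orthonormal_basis_finite:
  fixes V :: "'a::euclidean_space set"
  assumes "subspace V"
  obtains B where "B \<subseteq> V" "pairwise orthogonal B" "\<And>b. b \<in> B \<Longrightarrow> norm b = 1" "finite B" "span B = V"
  using orthonormal_basis_subspace[OF assms] independent_imp_finite by metis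

lemma seminorm_on_bounded:
  assumes N: "seminorm_on V N" and V: "subspace V"
  obtains C where "0 \<le> C" "\<And>x. x \<in> V \<Longrightarrow> N x \<le> C * norm x"
proof -
  obtain B where B: "B \<subseteq> V" "pairwise orthogonal B" "\<And>b. b \<in> B \<Longrightarrow> norm b = 1" "finite B" "span B = V"
    using orthonormal_basis_finite[OF V] by metis
  show thesis
  proof (rule that[of "\<Sum>b\<in>B. N b"])
    show "0 \<le> (\<Sum>b\<in>B. N b)" using B(1) seminorm_onD(1)[OF N] by (auto intro: sum_nonneg)
  qed (rule seminorm_on_le_norm[OF N V B])
qed

lemma seminorm_on_continuous:
  assumes N: "seminorm_on V N" and V: "subspace V"
  shows "continuous_on V N"
proof -
  obtain C where C: "0 \<le> C" "\<And>x. x \<in> V \<Longrightarrow> N x \<le> C * norm x"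
    using seminorm_on_bounded[OF N V] by blast
  have le: "N x - N y \<le> C * dist x y" if "x \<in> V" "y \<in> V" for x y
  proof -
    have d: "x - y \<in> V" using V that by (simp add: subspace_diff)
    have "N x \<le> N (x - y) + N y" using seminorm_onD(2)[OF N d that(2)] by simp
    then show ?thesis using C(2)[OF d] by (simp add: dist_norm)
  qed
  have "dist (N x) (N y) \<le> C * dist x y" if "x \<in> V" "y \<in> V" for x y
    using le[OF that] le[OF that(2,1)] by (simp add: dist_real_def dist_commute)
  then have "C-lipschitz_on V N" using C(1) by (intro lipschitz_onI) auto
  then show ?thesis by (rule lipschitz_on_continuous_on)
qed

text \<open>Definiteness makes the minimum of \<open>N\<close> on the compact unit sphere of
  \<open>V\<close> positive; homogeneity does the rest.\<close>

lemma definite_seminorm_on_lower_bound: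
  assumes N: "seminorm_on V N" and V: "subspace V" and def: "\<And>x. x \<in> V \<Longrightarrow> N x = 0 \<Longrightarrow> x = 0"
  obtains c where "0 < c" "\<And>x. x \<in> V \<Longrightarrow> norm x \<le> c * N x"
proof (cases "V \<inter> sphere 0 1 = {}")
  case True
  have V0: "x = 0" if "x \<in> V" for x
  proof (rule ccontr)
    assume "x \<noteq> 0"
    then have "norm ((1 / norm x) *\<^sub>R x) = 1" by simp
    moreover have "(1 / norm x) *\<^sub>R x \<in> V" using that V by (rule subspace_scale[rotated])
    ultimately show False using True by (metis disjoint_iff mem_sphere_0)
  qed
  show thesis
  proof (rule that[of 1])
    fix x assume x: "x \<in> V"
    have "norm x = 0" using V0[OF x] by simp
    then show "norm x \<le> 1 * N x" using seminorm_onD(1)[OF N x] by linarith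
  qed simp
next
  case False
  have "compact (V \<inter> sphere 0 1)"
    using V by (intro closed_Int_compact closed_subspace) auto
  moreover have "continuous_on (V \<inter> sphere 0 1) N"
    by (rule continuous_on_subset[OF seminorm_on_continuous[OF N V]]) blast
  ultimately obtain v where v: "v \<in> V" "norm v = 1" "\<And>x. x \<in> V \<Longrightarrow> norm x = 1 \<Longrightarrow> N v \<le> N x"
    using continuous_attains_inf[OF _ False, of N] by (metis Int_iff mem_sphere_0)
  have pos: "0 < N v" using seminorm_onD(1)[OF N v(1)] def[OF v(1)] v(2)
    by force
  show thesis
  proof (rule that[of "1 / N v"])
    fix x assume x: "x \<in> V"
    show "norm x \<le> 1 / N v * N x"
    proof (cases "x = 0")
      case False
      have "(1 / norm x) *\<^sub>R x \<in> V" using x V by (simp add: subspace_scale)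
      then have "N v \<le> N ((1 / norm x) *\<^sub>R x)" using False by (intro v(3)) auto
      also have "\<dots> = 1 / norm x * N x" using seminorm_onD(3)[OF N x] by simp
      finally show ?thesis using False pos by (simp add: field_simps)
    qed (use pos seminorm_on_0[OF N] x in auto)
  qed (use pos in simp)
qed

section \<open>Gluing seminorms along an invariant subspace\<close>

text \<open>Composition with \<open>P\<close> extends a norm that lives on \<open>W\<close> to a
  seminorm on the whole space.\<close>

lemma linear_projection_onto:
  fixes W :: "'a::euclidean_space set"
  assumes "subspace W"
  obtains P where "linear P" "\<And>x. P x \<in> W" "\<And>x. x \<in> W \<Longrightarrow> P x = x"
proof -
  have "linear (\<lambda>x::'a. x)" by (rule linear_ident)
  from real_vector.linear_exists_left_inverse_on[OF this assms]
  obtain P where "P ` UNIV \<subseteq> W" "linear P" "\<forall>x\<in>W. P x = x"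
    by (auto simp: inj_on_def)
  then show thesis by (intro that[of P]) auto
qed

text \<open>Induction on the dimension: the kernel of a contracting seminorm is again invariant, and a
  norm on the kernel is glued to a large multiple of the seminorm. The off-diagonal block is absorbed
  by the margin between \<open>r\<close> and \<open>s\<close>.\<close>

lemma contracting_norm_exists:
  fixes F :: "('a::euclidean_space \<Rightarrow> 'a) set"
  assumes lin: "\<And>f. f \<in> F \<Longrightarrow> linear f"
    and bdd: "\<And>f x. f \<in> F \<Longrightarrow> norm (f x) \<le> b * norm x" "0 \<le> b"
    and rs: "0 < r" "r < s"
    and V: "subspace V" "\<And>f. f \<in> F \<Longrightarrow> f ` V \<subseteq> V"
    and semi: "\<And>V. subspace V \<Longrightarrow> (\<And>f. f \<in> F \<Longrightarrow> f ` V \<subseteq> V) \<Longrightarrow> V \<noteq> {0} \<Longrightarrow>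
       \<exists>N. seminorm_on V N \<and> (\<exists>x\<in>V. N x \<noteq> 0) \<and> (\<forall>f\<in>F. \<forall>x\<in>V. N (f x) \<le> r * N x)"
  shows "\<exists>N. seminorm_on V N \<and> (\<forall>x\<in>V. N x = 0 \<longrightarrow> x = 0) \<and> (\<forall>f\<in>F. \<forall>x\<in>V. N (f x) \<le> s * N x)"
  using V
proof (induction "dim V" arbitrary: V rule: less_induct)
  case less
  note V = less.prems
  show ?case
  proof (cases "V = {0}")
    case True
    then show ?thesis
      using linear_0[OF lin] by (intro exI[of _ "\<lambda>_. 0"]) (simp add: seminorm_on_def)
  next
    case False
    obtain N1 where N1: "seminorm_on V N1" "\<exists>x\<in>V. N1 x \<noteq> 0" "\<And>f x. f \<in> F \<Longrightarrow> x \<in> V \<Longrightarrow> N1 (f x) \<le> r * N1 x"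
      using semi[OF V False] by blast
    \<comment> \<open>The kernel of \<open>N1\<close> is invariant by the contraction inequality,
      and smaller than \<open>V\<close> because \<open>N1\<close> does not vanish on all of
      \<open>V\<close>.\<close>
    define W where "W = {x \<in> V. N1 x = 0}"
    have WV: "W \<subseteq> V" by (auto simp: W_def)
    have W: "subspace W"
    proof (rule subspaceI)
      show "0 \<in> W" using V(1) seminorm_on_0[OF N1(1)] by (simp add: W_def subspace_0)
      show "x + y \<in> W" if "x \<in> W" "y \<in> W" for x y
        using that V(1) seminorm_onD(2)[OF N1(1), of x y] seminorm_onD(1)[OF N1(1), of "x + y"]
        by (auto simp: W_def subspace_add)
      show "c *\<^sub>R x \<in> W" if "x \<in> W" for x c
        using that V(1) seminorm_onD(3)[OF N1(1), of x c] by (auto simp: W_def subspace_scale)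
    qed
    have fV: "f x \<in> V" if "f \<in> F" "x \<in> V" for f x
      using V(2) that by blast
    have invW: "f x \<in> W" if "f \<in> F" "x \<in> W" for f x
      using that fV[of f x] N1(3)[of f x] seminorm_onD(1)[OF N1(1), of "f x"] by (auto simp: W_def)
    have dim_less: "dim W < dim V"
      using N1(2) WV W V(1) dim_subset[OF WV] subspace_dim_equal[OF W V(1) WV]
      by (force simp: W_def)
    have "f ` W \<subseteq> W" if "f \<in> F" for f using invW[OF that] by blast
    from less.hyps[OF dim_less W this] obtain N2
      where N2: "seminorm_on W N2" "\<And>x. x \<in> W \<Longrightarrow> N2 x = 0 \<Longrightarrow> x = 0"
        "\<And>f x. f \<in> F \<Longrightarrow> x \<in> W \<Longrightarrow> N2 (f x) \<le> s * N2 x" by blast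
    obtain P where P: "linear P" "\<And>x. P x \<in> W" "\<And>x. x \<in> W \<Longrightarrow> P x = x"
      using linear_projection_onto[OF W] by blast
    have PV: "P x \<in> V" "x - P x \<in> V" if "x \<in> V" for x
      using P(2)[of x] WV that V(1) by (auto intro: subspace_diff)
    \<comment> \<open>A complement of \<open>W\<close> in \<open>V\<close>. On it \<open>N1\<close>
      is definite: a vector of \<open>U\<close> with \<open>N1 x = 0\<close> lies in
      \<open>W\<close>, is therefore fixed by \<open>P\<close>, and yet is sent to 0.\<close>
    define U where "U = V \<inter> {x. P x = 0}"
    have U: "subspace U"
      unfolding U_def using V(1) linear_subspace_kernel[OF P(1)] by (rule subspace_inter)
    have dU: "x - P x \<in> U" if "x \<in> V" for x
      using PV(2)[OF that] linear_diff[OF P(1), of x "P x"] P(2,3) by (auto simp: U_def)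
    have "seminorm_on U N1" by (rule seminorm_on_subset[OF N1(1)]) (auto simp: U_def)
    moreover have "x = 0" if "x \<in> U" "N1 x = 0" for x
      using that P(3)[of x] by (auto simp: U_def W_def)
    ultimately obtain c where c: "0 < c" "\<And>x. x \<in> U \<Longrightarrow> norm x \<le> c * N1 x"
      using definite_seminorm_on_lower_bound[OF _ U] by blast
    obtain C where C: "0 \<le> C" "\<And>x. x \<in> W \<Longrightarrow> N2 x \<le> C * norm x"
      using seminorm_on_bounded[OF N2(1) W] by blast
    obtain p where p: "0 < p" "\<And>x. norm (P x) \<le> norm x * p"
      using bounded_linear.pos_bounded linear_conv_bounded_linear P(1) by metis
    \<comment> \<open>The off-diagonal block sends the component in \<open>U\<close> to
      \<open>W\<close>. Its bound collects \<open>c\<close> (norm against \<open>N1\<close> on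
      \<open>U\<close>), \<open>b\<close> (the maps), \<open>p\<close> (the projection) and
      \<open>C\<close> (\<open>N2\<close> against the norm).\<close>
    define d where "d = C * (b * c * p)"
    have d: "0 \<le> d" using C(1) bdd(2) c(1) p(1) by (simp add: d_def)
    \<comment> \<open>Going from \<open>r\<close> to \<open>s\<close> gains
      \<open>L * (s - r) * N1 x\<close>, which has to pay for the off-diagonal
      \<open>d * N1 x\<close>. The 1 keeps \<open>L\<close> positive when
      \<open>d = 0\<close>.\<close>
    define L where "L = (d + 1) / (s - r)"
    have L: "0 < L" "L * (s - r) = d + 1" using rs(2) d by (auto simp: L_def)
    define N where "N x = L * N1 x + N2 (P x)" for x
    have off_diagonal: "N2 (P (f (x - P x))) \<le> d * N1 x" if f: "f \<in> F" and x: "x \<in> V" for f x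
    proof -
      have "N1 (x - P x) \<le> N1 x + N1 (P x)" by (rule seminorm_on_diff[OF N1(1) V(1) x PV(1)[OF x]])
      also have "N1 (P x) = 0" using P(2)[of x] by (simp add: W_def)
      finally have N1: "N1 (x - P x) \<le> N1 x" by simp
      have "norm (x - P x) \<le> c * N1 x"
        using order_trans[OF c(2)[OF dU[OF x]] mult_left_mono[OF N1]] c(1) by simp
      then have *: "b * norm (x - P x) * p \<le> b * (c * N1 x) * p"
        using bdd(2) p(1) by (intro mult_right_mono mult_left_mono) auto
      have "norm (P (f (x - P x))) \<le> norm (f (x - P x)) * p" by (rule p(2))
      also have "\<dots> \<le> b * norm (x - P x) * p" using bdd(1)[OF f] p(1) by (intro mult_right_mono) auto
      finally have "norm (P (f (x - P x))) \<le> b * c * p * N1 x" using * by (simp add: mult_ac)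
      then have "C * norm (P (f (x - P x))) \<le> d * N1 x"
        using mult_left_mono[OF _ C(1)] by (fastforce simp: d_def mult.assoc)
      then show ?thesis using C(2)[OF P(2)[of "f (x - P x)"]] by simp
    qed
    have "seminorm_on V N"
      unfolding seminorm_on_def
    proof (intro conjI ballI allI)
      fix x assume x: "x \<in> V"
      show "0 \<le> N x" using seminorm_onD(1)[OF N1(1) x] seminorm_onD(1)[OF N2(1) P(2)[of x]] L by (simp add: N_def)
      show "N (e *\<^sub>R x) = \<bar>e\<bar> * N x" for e
        using seminorm_onD(3)[OF N1(1) x] seminorm_onD(3)[OF N2(1) P(2)[of x]]
        by (simp add: N_def linear_cmul[OF P(1)] algebra_simps)
      fix y assume y: "y \<in> V"
      show "N (x + y) \<le> N x + N y"
        using mult_left_mono[OF seminorm_onD(2)[OF N1(1) x y], of L] L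
          seminorm_onD(2)[OF N2(1) P(2)[of x] P(2)[of y]]
        by (simp add: N_def linear_add[OF P(1)] algebra_simps)
    qed
    moreover have "x = 0" if x: "x \<in> V" "N x = 0" for x
    proof -
      have "0 \<le> N1 x" "0 \<le> N2 (P x)" using seminorm_onD(1) N1(1) N2(1) P(2)[of x] x by blast+
      then have "N1 x = 0" "N2 (P x) = 0"
        using x(2) L(1) by (auto simp: N_def add_nonneg_eq_0_iff)
      then show "x = 0" using x(1) N2(2)[OF P(2)[of x]] P(3)[of x] by (simp add: W_def)
    qed
    moreover have "N (f x) \<le> s * N x" if f: "f \<in> F" and x: "x \<in> V" for f x
    proof -
      \<comment> \<open>The image of \<open>P x\<close> stays in \<open>W\<close> and is fixed by
        \<open>P\<close>, so only the component in \<open>U\<close> produces an off-diagonal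
        term.\<close>
      have "f x = f (P x) + f (x - P x)" using linear_add[OF lin[OF f], of "P x" "x - P x"] by simp
      then have "P (f x) = f (P x) + P (f (x - P x))"
        using linear_add[OF P(1)] P(3)[OF invW[OF f P(2)[of x]]] by simp
      then have "N2 (P (f x)) \<le> N2 (f (P x)) + N2 (P (f (x - P x)))"
        using seminorm_onD(2)[OF N2(1) invW[OF f P(2)[of x]] P(2)] by simp
      also have "\<dots> \<le> s * N2 (P x) + d * N1 x"
        using N2(3)[OF f P(2)[of x]] off_diagonal[OF f x] by simp
      finally have "N (f x) \<le> L * (r * N1 x) + (s * N2 (P x) + d * N1 x)"
        unfolding N_def using L(1) by (intro add_mono mult_left_mono N1(3)[OF f x]) auto
      also have "\<dots> = s * N x - (L * (s - r) - d) * N1 x" by (simp add: N_def algebra_simps)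
      also have "\<dots> \<le> s * N x" using L(2) seminorm_onD(1)[OF N1(1) x] by simp
      finally show ?thesis .
    qed
    ultimately show ?thesis by blast
  qed
qed

text \<open>The limit seminorm is the upper limit of the \<open>N j\<close>, each normalised to have sum 1 on an
  orthonormal basis.\<close>

lemma limit_seminorm_exists:
  fixes N :: "nat \<Rightarrow> 'a::euclidean_space \<Rightarrow> real"
  assumes V: "subspace V" "V \<noteq> {0}"
    and N: "\<And>j. seminorm_on V (N j)" and def: "\<And>j x. x \<in> V \<Longrightarrow> N j x = 0 \<Longrightarrow> x = 0"
    and s: "0 \<le> s"
  obtains L where "seminorm_on V L" "\<exists>x\<in>V. L x \<noteq> 0"
    "\<And>x z. x \<in> V \<Longrightarrow> z \<in> V \<Longrightarrow>
       (\<And>e. 0 < e \<Longrightarrow> \<forall>\<^sub>F j in sequentially. \<exists>y\<in>V. norm (z - y) \<le> e \<and> N j y \<le> (s + e) * N j x) \<Longrightarrow>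
       L z \<le> s * L x"
proof -
  obtain B where B: "B \<subseteq> V" "pairwise orthogonal B" "\<And>b. b \<in> B \<Longrightarrow> norm b = 1" "finite B" "span B = V"
    using orthonormal_basis_finite[OF V(1)] by metis
  have Bne: "B \<noteq> {}" using B(5) V(2) by auto
  define c where "c j = (\<Sum>b\<in>B. N j b)" for j
  have c: "0 < c j" for j
    unfolding c_def
  proof (rule sum_pos[OF B(4) Bne])
    fix b assume b: "b \<in> B"
    then have "b \<in> V" "b \<noteq> 0" using B(1,3) by force+
    then show "0 < N j b" using seminorm_onD(1)[OF N, of b j] def[of b j] by fastforce
  qed
  \<comment> \<open>The values of \<open>u j\<close> on \<open>B\<close> sum to 1, whence
    \<open>u j x \<le> norm x\<close> for all \<open>j\<close>.\<close>
  define u where "u j x = N j x / c j" for j x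
  have u0: "0 \<le> u j x" if "x \<in> V" for j x
    using seminorm_onD(1)[OF N that] c[of j] by (simp add: u_def)
  have u_le: "u j x \<le> norm x" if "x \<in> V" for j x
    using seminorm_on_le_norm[OF N V(1) B that, of j] c[of j]
    by (simp add: u_def c_def pos_divide_le_eq mult.commute)
  have u_add: "u j (x + y) \<le> u j x + u j y" if "x \<in> V" "y \<in> V" for j x y
    using seminorm_onD(2)[OF N that] c[of j] by (simp add: u_def divide_right_mono flip: add_divide_distrib)
  have u_scale: "u j (t *\<^sub>R x) = \<bar>t\<bar> * u j x" if "x \<in> V" for j t x
    using seminorm_onD(3)[OF N that] by (simp add: u_def)
  \<comment> \<open>A real-valued limit superior: the infimum of the eventual upper bounds, a set
    that contains \<open>norm x\<close> and is bounded below by 0. Upper limits, unlike lower ones,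
    inherit subadditivity.\<close>
  define L where "L x = Inf {a. \<forall>\<^sub>F j in sequentially. u j x \<le> a}" for x
  have nonneg: "0 \<le> a" if x: "x \<in> V" and a: "\<forall>\<^sub>F j in sequentially. u j x \<le> a" for a x
  proof -
    obtain j where "u j x \<le> a" using eventually_happens[OF a] by auto
    then show ?thesis using u0[OF x, of j] by simp
  qed
  have L_le: "L x \<le> a" if "x \<in> V" "\<forall>\<^sub>F j in sequentially. u j x \<le> a" for a x
    unfolding L_def using that nonneg[OF that(1)] by (intro cInf_lower bdd_belowI[of _ 0]) auto
  have L_le': "L x \<le> a" if x: "x \<in> V" and H: "\<And>e. 0 < e \<Longrightarrow> \<forall>\<^sub>F j in sequentially. u j x \<le> a + e" for a x
  proof (rule field_le_epsilon)
    fix e :: real assume "0 < e"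
    then show "L x \<le> a + e" by (rule L_le[OF x H])
  qed
  have ne: "{a. \<forall>\<^sub>F j in sequentially. u j x \<le> a} \<noteq> {}" if "x \<in> V" for x
  proof -
    have "norm x \<in> {a. \<forall>\<^sub>F j in sequentially. u j x \<le> a}" using u_le[OF that] by simp
    then show ?thesis by blast
  qed
  have ev: "\<forall>\<^sub>F j in sequentially. u j x \<le> L x + e" if x: "x \<in> V" and e: "0 < e" for x e
  proof -
    have "Inf {a. \<forall>\<^sub>F j in sequentially. u j x \<le> a} < L x + e" using e by (simp add: L_def)
    from cInf_lessD[OF ne[OF x] this]
    obtain a where "\<forall>\<^sub>F j in sequentially. u j x \<le> a" "a < L x + e" by auto
    then show ?thesis by (auto elim: eventually_mono)
  qed
  have L0: "0 \<le> L x" if "x \<in> V" for x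
    unfolding L_def using nonneg[OF that] by (intro cInf_greatest[OF ne[OF that]]) auto
  have L_scale: "L (t *\<^sub>R x) \<le> \<bar>t\<bar> * L x" if x: "x \<in> V" for t x
  proof (rule L_le'[OF subspace_scale[OF V(1) x]])
    fix e :: real assume e: "0 < e"
    \<comment> \<open>The 1 in the denominator covers \<open>t = 0\<close>.\<close>
    define e' where "e' = e / (\<bar>t\<bar> + 1)"
    have "0 < e'" "\<bar>t\<bar> * e' \<le> e" using e by (auto simp: e'_def field_simps)
    moreover from ev[OF x this(1)]
    have "\<forall>\<^sub>F j in sequentially. \<bar>t\<bar> * u j x \<le> \<bar>t\<bar> * (L x + e')"
      by (rule eventually_mono) (auto intro: mult_left_mono)
    ultimately show "\<forall>\<^sub>F j in sequentially. u j (t *\<^sub>R x) \<le> \<bar>t\<bar> * L x + e"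
      by (auto elim!: eventually_mono simp: u_scale[OF x] distrib_left)
  qed
  show thesis
  proof (rule that[of L])
    show "seminorm_on V L"
      unfolding seminorm_on_def
    proof (intro conjI ballI allI)
      fix x assume x: "x \<in> V"
      show "0 \<le> L x" by (rule L0[OF x])
      show "L (t *\<^sub>R x) = \<bar>t\<bar> * L x" for t
      proof (cases "t = 0")
        case True
        have "L 0 \<le> 0" using L_scale[OF x, of 0] by simp
        then show ?thesis using True L0[of 0] V(1) by (simp add: subspace_0)
      next
        case False
        \<comment> \<open>The reverse inequality is the one already shown, for the factor
          \<open>1 / t\<close>.\<close>
        have "L x \<le> \<bar>1 / t\<bar> * L (t *\<^sub>R x)"
          using L_scale[OF subspace_scale[OF V(1) x, of t], of "1 / t"] False by simp
        then have "\<bar>t\<bar> * L x \<le> L (t *\<^sub>R x)" using False by (simp add: field_simps)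
        then show ?thesis using L_scale[OF x, of t] by simp
      qed
      fix y assume y: "y \<in> V"
      show "L (x + y) \<le> L x + L y"
      proof (rule L_le'[OF subspace_add[OF V(1) x y]])
        fix e :: real assume "0 < e"
        then have "0 < e / 2" by simp
        from ev[OF x this] ev[OF y this]
        show "\<forall>\<^sub>F j in sequentially. u j (x + y) \<le> L x + L y + e"
          by eventually_elim (use u_add[OF x y] in \<open>smt (verit) field_sum_of_halves\<close>)
      qed
    qed
    show "\<exists>x\<in>V. L x \<noteq> 0"
    proof (rule ccontr)
      assume "\<not> (\<exists>x\<in>V. L x \<noteq> 0)"
      then have L_0: "L b = 0" if "b \<in> B" for b using B(1) that by blast
      \<comment> \<open>If \<open>L\<close> vanished on the basis, then for large \<open>j\<close>
        the basis values of \<open>u j\<close> would sum to at most 1/2 instead of 1.\<close>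
      define e where "e = 1 / (2 * real (card B))"
      have cB: "0 < card B" using B(4) Bne by (simp add: card_gt_0_iff)
      then have e: "0 < e" by (simp add: e_def)
      have "\<forall>b\<in>B. \<forall>\<^sub>F j in sequentially. u j b \<le> e"
        using ev[OF _ e] B(1) L_0 by fastforce
      then have "\<forall>\<^sub>F j in sequentially. \<forall>b\<in>B. u j b \<le> e" by (rule eventually_ball_finite[OF B(4)])
      then obtain j where j: "\<And>b. b \<in> B \<Longrightarrow> u j b \<le> e" using eventually_happens by force
      have "1 = (\<Sum>b\<in>B. u j b)" using c[of j] by (simp add: u_def c_def flip: sum_divide_distrib)
      also have "\<dots> \<le> card B * e" using j by (rule sum_bounded_above)
      also have "\<dots> = 1 / 2" using cB by (simp add: e_def)
      finally show False by simp
    qed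
    \<comment> \<open>The vector \<open>y\<close> may change with \<open>j\<close> and need only be
      close to \<open>z\<close>: later it is \<open>B ** X\<close> for some \<open>B\<close> near
      \<open>A\<close> that depends on \<open>j\<close>.\<close>
    fix x z assume x: "x \<in> V" and z: "z \<in> V"
      and H: "\<And>e. 0 < e \<Longrightarrow> \<forall>\<^sub>F j in sequentially. \<exists>y\<in>V. norm (z - y) \<le> e \<and> N j y \<le> (s + e) * N j x"
    show "L z \<le> s * L x"
    proof (rule L_le'[OF z])
      fix e :: real assume e: "0 < e"
      \<comment> \<open>Three errors add up to \<open>e\<close>: \<open>d\<close> from
        \<open>z - y\<close>, \<open>d * norm x\<close> from the factor \<open>s + d\<close>, and
        \<open>s * d\<close> from the upper limit.\<close>
      define d where "d = e / (s + norm x + 1)"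
      have s1: "0 < s + norm x + 1" using s by (smt (verit) norm_ge_zero)
      then have d: "0 < d" using e by (simp add: d_def)
      have "d * (s + norm x + 1) = e" using s1 by (simp add: d_def)
      then have de: "s * d + d * norm x + d = e" by (simp add: algebra_simps)
      from H[OF d] ev[OF x d] show "\<forall>\<^sub>F j in sequentially. u j z \<le> s * L x + e"
      proof eventually_elim
        case (elim j)
        then obtain y where y: "y \<in> V" "norm (z - y) \<le> d" "N j y \<le> (s + d) * N j x" by blast
        have zy: "z - y \<in> V" using V(1) z y(1) by (rule subspace_diff)
        have "u j z \<le> u j (z - y) + u j y" using u_add[OF zy y(1)] by simp
        also have "u j (z - y) \<le> d" using u_le[OF zy, of j] y(2) by simp
        also have "u j y \<le> (s + d) * u j x"
          using divide_right_mono[OF y(3), of "c j"] c[of j] by (simp add: u_def)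
        also have "(s + d) * u j x = s * u j x + d * u j x" by (simp add: distrib_right)
        also have "s * u j x \<le> s * (L x + d)" using elim(2) s by (rule mult_left_mono)
        also have "d * u j x \<le> d * norm x" using u_le[OF x] d by (simp add: mult_left_mono)
        finally show ?case using de by (simp add: distrib_left)
      qed
    qed
  qed
qed

section \<open>Convexity of powers and submultiplicative sequences\<close>

text \<open>By induction; the defect in the step is
  \<open>s * t * ((a - b) * (a ^ n - b ^ n))\<close>, where the two differences never have opposite
  signs.\<close>

lemma convex_power_combination:
  fixes a b s t :: real
  assumes "0 \<le> a" "0 \<le> b" "0 \<le> s" "0 \<le> t" "s + t = 1"
  shows "(s * a + t * b) ^ n \<le> s * a ^ n + t * b ^ n"
proof (induction n)
  case (Suc n)
  have "(s * a + t * b) ^ Suc n \<le> (s * a + t * b) * (s * a ^ n + t * b ^ n)"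
    using Suc assms by (simp add: mult_left_mono)
  also have "\<dots> = (s + t) * (s * a ^ Suc n + t * b ^ Suc n) - s * t * ((a - b) * (a ^ n - b ^ n))"
    by (simp add: algebra_simps)
  also have "\<dots> \<le> s * a ^ Suc n + t * b ^ Suc n"
  proof -
    have "0 \<le> (a - b) * (a ^ n - b ^ n)"
    proof (cases "a \<le> b")
      case True
      then show ?thesis using assms power_mono[of a b n] by (intro mult_nonpos_nonpos) auto
    next
      case False
      then show ?thesis using assms power_mono[of b a n] by (intro mult_nonneg_nonneg) auto
    qed
    then show ?thesis using assms by simp
  qed
  finally show ?case .
qed (use assms in simp)

lemma submultiplicative_power_le:
  fixes a :: "nat \<Rightarrow> real"
  assumes a0: "\<And>n. 0 \<le> a n" and sub: "\<And>m n. a (m + n) \<le> a m * a n"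
  shows "a (m * d + i) \<le> a m ^ d * a i"
proof (induction d)
  case (Suc d)
  have "a (m * Suc d + i) \<le> a m * a (m * d + i)"
    using sub[of m "m * d + i"] by (simp add: algebra_simps)
  also have "\<dots> \<le> a m * (a m ^ d * a i)" using Suc a0 by (intro mult_left_mono)
  finally show ?case by (simp add: mult_ac)
qed simp

text \<open>Fekete's lemma in multiplicative form; the limit is the infimum of the roots.\<close>

lemma submultiplicative_root_convergent:
  fixes a :: "nat \<Rightarrow> real"
  assumes a0: "\<And>n. 0 \<le> a n" and sub: "\<And>m n. a (m + n) \<le> a m * a n"
  shows "convergent (\<lambda>n. root n (a n))"
proof -
  \<comment> \<open>Index 0 is left out because \<open>root 0\<close> is constantly 0.\<close>
  define L where "L = Inf ((\<lambda>n. root n (a n)) ` {1..})"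
  have ne: "(\<lambda>n. root n (a n)) ` {1..} \<noteq> {}" by simp
  have bdd: "bdd_below ((\<lambda>n. root n (a n)) ` {1..})"
    using a0 by (intro bdd_belowI2[of _ 0]) auto
  have lower: "L \<le> root n (a n)" if "n \<ge> 1" for n
    unfolding L_def using bdd that by (intro cInf_lower) auto
  have L0: "0 \<le> L" unfolding L_def using a0 by (intro cInf_greatest[OF ne]) auto
  have upper: "\<forall>\<^sub>F n in sequentially. root n (a n) < x" if x: "L < x" for x
  proof -
    obtain m where m: "m \<ge> 1" "root m (a m) < x"
      using cInf_lessD[OF ne, of x] x by (auto simp: L_def)
    \<comment> \<open>The gap between \<open>q\<close> and \<open>x\<close> leaves room for the
      factor \<open>root n C\<close>, which tends to 1.\<close>
    obtain q where q: "root m (a m) < q" "q < x" using dense[OF m(2)] by blast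
    have q0: "0 < q" using q(1) a0[of m] m(1) by (smt (verit) real_root_ge_zero)
    have amq: "a m \<le> q ^ m"
    proof -
      have "root m (a m) ^ m \<le> q ^ m" using q(1) a0 by (intro power_mono) (auto intro: a0 real_root_ge_zero)
      then show ?thesis using a0 m(1) by simp
    qed
    \<comment> \<open>Bounds \<open>a i / q ^ i\<close> for every remainder \<open>i\<close> modulo
      \<open>m\<close>; the 1 makes it positive, so that its roots tend to 1.\<close>
    define C where "C = 1 + (\<Sum>i<m. a i / q ^ i)"
    have "0 \<le> (\<Sum>i<m. a i / q ^ i)" using a0 q0 by (intro sum_nonneg) auto
    then have C: "0 < C" by (simp add: C_def)
    have bound: "a n \<le> C * q ^ n" for n
    proof -
      define i where "i = n mod m"
      have n: "n = m * (n div m) + i" by (simp add: i_def)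
      have im: "i < m" using m(1) by (simp add: i_def)
      have "a i / q ^ i \<le> (\<Sum>i<m. a i / q ^ i)"
        using im a0 q0 by (intro member_le_sum) auto
      then have "a i / q ^ i \<le> C" by (simp add: C_def)
      then have ai: "a i \<le> C * q ^ i" using q0 by (simp add: field_simps)
      have "a n \<le> a m ^ (n div m) * a i"
        using submultiplicative_power_le[of a m "n div m" i] a0 sub n by simp
      also have "\<dots> \<le> (q ^ m) ^ (n div m) * (C * q ^ i)"
        using amq ai a0 q0 by (intro mult_mono power_mono) auto
      also have "\<dots> = C * q ^ (m * (n div m) + i)" by (simp add: power_add power_mult)
      also have "\<dots> = C * q ^ n" using n by simp
      finally show ?thesis .
    qed
    have "(\<lambda>n. root n C * q) \<longlonglongrightarrow> 1 * q" using C by (intro tendsto_intros LIMSEQ_root_const)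
    then have "\<forall>\<^sub>F n in sequentially. root n C * q < x" using q(2) by (intro order_tendstoD(2)) auto
    then show ?thesis using eventually_gt_at_top[of 0]
    proof eventually_elim
      case (elim n)
      have "root n (a n) \<le> root n (C * q ^ n)" using bound elim(2) by simp
      also have "\<dots> = root n C * q" using q0 elim(2) by (simp add: real_root_mult real_root_power_cancel)
      finally show ?case using elim(1) by simp
    qed
  qed
  have "(\<lambda>n. root n (a n)) \<longlonglongrightarrow> L"
  proof (rule order_tendstoI)
    fix x assume "x < L"
    then show "\<forall>\<^sub>F n in sequentially. x < root n (a n)"
      using lower by (intro eventually_sequentiallyI[of 1]) (auto intro: less_le_trans)
  qed (rule upper)
  then show ?thesis by (rule convergentI)
qed

text \<open>The root is the Minkowski functional of the convex set where \<open>g \<le> 1\<close>.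
  Its triangle inequality says that convex combinations of points with \<open>g = 1\<close> stay in
  this set.\<close>

lemma seminorm_on_root:
  fixes g :: "'a::euclidean_space \<Rightarrow> real"
  assumes p: "0 < p" and g0: "\<And>x. 0 \<le> g x" and hom: "\<And>c x. g (c *\<^sub>R x) = \<bar>c\<bar> ^ p * g x"
    and conv: "\<And>x y s t. 0 \<le> s \<Longrightarrow> 0 \<le> t \<Longrightarrow> s + t = 1 \<Longrightarrow> g (s *\<^sub>R x + t *\<^sub>R y) \<le> s * g x + t * g y"
    and def: "\<And>x. g x = 0 \<Longrightarrow> x = 0"
  shows "seminorm_on UNIV (\<lambda>x. root p (g x))"
proof -
  define N where "N x = root p (g x)" for x
  have N0: "0 \<le> N x" for x using g0 by (simp add: N_def real_root_ge_zero)
  have Np: "N x ^ p = g x" for x using p g0 by (simp add: N_def)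
  have N_hom: "N (c *\<^sub>R x) = \<bar>c\<bar> * N x" for c x
    using p by (simp add: N_def hom real_root_mult real_root_power_cancel)
  have N_pos: "0 < N x" if "x \<noteq> 0" for x
    using N0[of x] Np[of x] def[of x] that p by (metis order_le_less zero_power)
  have "N (x + y) \<le> N x + N y" for x y
  proof (cases "x = 0 \<or> y = 0")
    case True
    then show ?thesis using N0[of 0] by auto
  next
    case False
    define a where "a = N x + N y"
    have pos: "0 < N x" "0 < N y" "0 < a" using False N_pos by (auto simp: a_def add_pos_pos)
    \<comment> \<open>The weights are chosen so that \<open>a\<close> times this convex combination
      of the normalised vectors is \<open>x + y\<close>.\<close>
    define z where "z = (N x / a) *\<^sub>R ((1 / N x) *\<^sub>R x) + (N y / a) *\<^sub>R ((1 / N y) *\<^sub>R y)"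
    have unit: "g ((1 / N v) *\<^sub>R v) = 1" if "0 < N v" for v
      using that by (simp add: Np[symmetric] N_hom)
    have sum1: "N x / a + N y / a = 1" using pos by (simp add: a_def flip: add_divide_distrib)
    have "g z \<le> N x / a * 1 + N y / a * 1"
      unfolding z_def using conv[OF _ _ sum1, of "(1 / N x) *\<^sub>R x" "(1 / N y) *\<^sub>R y"] pos unit by simp
    then have "g z \<le> 1" using sum1 by simp
    then have "N z \<le> 1" using p by (simp add: N_def)
    moreover have "x + y = a *\<^sub>R z" using pos by (simp add: z_def scaleR_add_right)
    ultimately show ?thesis using N_hom[of a z] pos mult_left_mono[of "N z" 1 a] by (simp add: a_def)
  qed
  then show ?thesis using N0 N_hom unfolding seminorm_on_def N_def by simp
qed

section \<open>The support of a measure and the operator norm\<close>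

text \<open>Every point outside the support lies in a null set of a countable basis, so countably
  many null sets cover the complement.\<close>

lemma AE_supp:
  fixes \<mu> :: "'a::second_countable_topology measure"
  assumes sets: "sets \<mu> = sets borel"
  shows "AE x in \<mu>. x \<in> supp \<mu>"
proof -
  obtain B :: "'a set set" where B: "countable B" "topological_basis B"
    using ex_countable_basis by blast
  define C where "C = {U \<in> B. emeasure \<mu> U = 0}"
  have "countable C" using B(1) by (simp add: C_def)
  have open_C: "open U" if "U \<in> B" for U using B(2) that by (rule topological_basis_open)
  have "(\<Union>U\<in>C. U) \<in> null_sets \<mu>"
    using open_C sets by (intro null_sets_UN' \<open>countable C\<close>) (auto simp: C_def null_sets_def)
  moreover have "{x \<in> space \<mu>. x \<notin> supp \<mu>} \<subseteq> (\<Union>U\<in>C. U)"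
  proof
    fix x assume "x \<in> {x \<in> space \<mu>. x \<notin> supp \<mu>}"
    then obtain U where U: "open U" "x \<in> U" "emeasure \<mu> U = 0" by (auto simp: supp_def)
    obtain V where V: "V \<in> B" "x \<in> V" "V \<subseteq> U" by (rule topological_basisE[OF B(2) U(1,2)])
    have "emeasure \<mu> V \<le> emeasure \<mu> U" using U(1) V(3) sets by (intro emeasure_mono) auto
    then show "x \<in> (\<Union>U\<in>C. U)" using U(3) V by (auto simp: C_def)
  qed
  ultimately show ?thesis by (rule AE_I')
qed

lemma linear_matrix_mul_left: "linear (\<lambda>X::real^'n^'n. (A::real^'n^'n) ** X)"
  by (rule linearI) (simp_all add: matrix_matrix_mult_def vec_eq_iff sum.distrib sum_distrib_left algebra_simps)

lemma continuous_matrix_mul: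
  "continuous_on UNIV (\<lambda>x::(real^'n^'n) \<times> (real^'n^'n). fst x ** snd x)"
  unfolding matrix_matrix_mult_def
  by (intro continuous_on_vec_lambda continuous_on_sum continuous_intros)

lemma max_singular_value_nonneg: "0 \<le> max_singular_value A"
  unfolding max_singular_value_eq_onorm by (rule onorm_pos_le) (rule matrix_vector_mul_bounded_linear)

lemma seminorm_max_singular_value: "seminorm_on UNIV (max_singular_value :: real^'n^'n \<Rightarrow> real)"
proof -
  have "onorm ((*v) (A + B)) \<le> onorm ((*v) A) + onorm ((*v) B)" for A B :: "real^'n^'n"
    unfolding matrix_vector_mult_add_rdistrib
    by (rule onorm_triangle) (rule matrix_vector_mul_bounded_linear)+
  moreover have "onorm ((*v) (c *\<^sub>R A)) = \<bar>c\<bar> * onorm ((*v) A)" for c and A :: "real^'n^'n"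
    unfolding scaleR_matrix_vector_assoc[symmetric]
    by (rule onorm_scaleR) (rule matrix_vector_mul_bounded_linear)
  ultimately show ?thesis
    unfolding seminorm_on_def
    by (simp add: max_singular_value_eq_onorm max_singular_value_nonneg[unfolded max_singular_value_eq_onorm])
qed

lemma max_singular_value_eq_0: "max_singular_value A = 0 \<Longrightarrow> A = 0"
  unfolding max_singular_value_eq_onorm onorm_eq_0[OF matrix_vector_mul_bounded_linear]
  by (simp add: matrix_eq)

lemma max_singular_value_mult: "max_singular_value (A ** B) \<le> max_singular_value A * max_singular_value B"
proof -
  have "(*v) (A ** B) = (*v) A \<circ> (*v) B" by (simp add: fun_eq_iff matrix_vector_mul_assoc)
  then show ?thesis
    unfolding max_singular_value_eq_onorm
    by (metis onorm_compose matrix_vector_mul_bounded_linear)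
qed

subsection \<open>Averages over random products\<close>

text \<open>The Markov operator of the random walk that multiplies by an independent factor on the
  left. Values in \<open>ennreal\<close> spare integrability conditions during iteration.\<close>

definition left_average :: "(real^'n^'n) measure \<Rightarrow> (real^'n^'n \<Rightarrow> ennreal) \<Rightarrow> real^'n^'n \<Rightarrow> ennreal" where
  "left_average \<mu> f X = (\<integral>\<^sup>+B. f (B ** X) \<partial>\<mu>)"

locale bounded_matrix_law = prob_space \<mu> for \<mu> :: "(real^'n^'n) measure" +
  assumes sets_borel [measurable_cong]: "sets \<mu> = sets borel"
    and bounded_supp: "bounded (supp \<mu>)"
begin

lemma supp_nonempty: "supp \<mu> \<noteq> {}"
proof
  assume "supp \<mu> = {}"
  then have "AE x in \<mu>. False" using AE_supp[OF sets_borel] by simp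
  then show False by simp
qed

lemma supp_bound:
  obtains b where "0 \<le> b" "\<And>B. B \<in> supp \<mu> \<Longrightarrow> max_singular_value B \<le> b"
proof -
  obtain C where C: "0 \<le> C" "\<And>X::real^'n^'n. max_singular_value X \<le> C * norm X"
    using seminorm_on_bounded[OF seminorm_max_singular_value subspace_UNIV] by auto
  obtain a where a: "\<And>B. B \<in> supp \<mu> \<Longrightarrow> norm B \<le> a" using bounded_supp by (auto simp: bounded_iff)
  show thesis
  proof (rule that[of "C * \<bar>a\<bar>"])
    fix B assume "B \<in> supp \<mu>"
    then have "C * norm B \<le> C * \<bar>a\<bar>" using a[of B] C(1) by (intro mult_left_mono) auto
    then show "max_singular_value B \<le> C * \<bar>a\<bar>" using C(2)[of B] by linarith
  qed (use C(1) in simp)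
qed

lemma measurable_mul_right [measurable]: "(\<lambda>B. B ** (X :: real^'n^'n)) \<in> \<mu> \<rightarrow>\<^sub>M borel"
proof -
  have "continuous_on UNIV (\<lambda>B::real^'n^'n. fst (B, X) ** snd (B, X))"
    by (rule continuous_on_compose2[OF continuous_matrix_mul]) (auto intro!: continuous_intros)
  then have "(\<lambda>B::real^'n^'n. B ** X) \<in> borel \<rightarrow>\<^sub>M borel" by (intro borel_measurable_continuous_onI) simp
  then show ?thesis using measurable_cong_sets[OF sets_borel refl] by blast
qed

lemma borel_measurable_left_average [measurable]:
  assumes [measurable]: "f \<in> borel_measurable borel"
  shows "left_average \<mu> f \<in> borel_measurable borel"
proof -
  have "(\<lambda>x :: (real^'n^'n) \<times> (real^'n^'n). snd x ** fst x) \<in> borel \<Otimes>\<^sub>M borel \<rightarrow>\<^sub>M (borel :: (real^'n^'n) measure)"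
    by (rule borel_measurable_continuous_Pair[where H = "(**)"]) (auto intro: continuous_matrix_mul)
  moreover have "sets (borel \<Otimes>\<^sub>M borel) = sets (borel \<Otimes>\<^sub>M \<mu>)"
    using sets_borel by (intro sets_pair_measure_cong) auto
  ultimately have "(\<lambda>x :: (real^'n^'n) \<times> (real^'n^'n). snd x ** fst x) \<in> borel \<Otimes>\<^sub>M \<mu> \<rightarrow>\<^sub>M borel"
    using measurable_cong_sets by blast
  then have "(\<lambda>(X, B). f (B ** X)) \<in> borel_measurable (borel \<Otimes>\<^sub>M \<mu>)"
    by (simp add: case_prod_beta)
  then show ?thesis unfolding left_average_def by (rule borel_measurable_nn_integral)
qed

lemma borel_measurable_left_average_iterate [measurable]:
  "f \<in> borel_measurable borel \<Longrightarrow> (left_average \<mu> ^^ k) f \<in> borel_measurable borel"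
  by (induction k) auto

abbreviation words :: "nat \<Rightarrow> (nat \<Rightarrow> real^'n^'n) measure" where
  "words k \<equiv> \<Pi>\<^sub>M i\<in>{1..k}. \<mu>"

lemma measurable_left_prod_words [measurable]: "j \<le> k \<Longrightarrow> (\<lambda>A. left_prod A j) \<in> words k \<rightarrow>\<^sub>M borel"
  using measurable_left_prod measurable_cong_sets[OF sets_PiM_cong[OF refl sets_borel] refl] by blast

text \<open>The factor with the highest index stands leftmost, and integrating it out first turns
  \<open>f\<close> into \<open>left_average \<mu> f\<close>. This is why \<open>f\<close> varies in
  the induction while \<open>X\<close> stays fixed.\<close>

lemma nn_integral_left_prod:
  assumes "f \<in> borel_measurable borel"
  shows "(\<integral>\<^sup>+A. f (left_prod A k ** X) \<partial>words k) = (left_average \<mu> ^^ k) f X"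
  using assms
proof (induction k arbitrary: f)
  case 0
  interpret P: prob_space "words 0" by (rule prob_space_PiM) (rule prob_space_axioms)
  show ?case using P.emeasure_space_1 by simp
next
  case (Suc k)
  note [measurable] = Suc.prems
  interpret product_sigma_finite "\<lambda>_. \<mu>" by standard
  have eq: "left_prod (A(Suc k := B)) (Suc k) = B ** left_prod A k" for A B
    using left_prod_cong[of k "A(Suc k := B)" A] by simp
  have *: "{1..Suc k} = insert (Suc k) {1..k}" by auto
  have [measurable]: "(\<lambda>Y::real^'n^'n. Y ** X) \<in> borel \<rightarrow>\<^sub>M borel"
    using measurable_mul_right measurable_cong_sets[OF sets_borel refl] by blast
  have meas: "(\<lambda>A. f (left_prod A (Suc k) ** X)) \<in> borel_measurable (words (Suc k))"
    using measurable_left_prod_words[of "Suc k" "Suc k"] by measurable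
  have "(\<integral>\<^sup>+A. f (left_prod A (Suc k) ** X) \<partial>words (Suc k)) =
      (\<integral>\<^sup>+A. (\<integral>\<^sup>+B. f (left_prod (A(Suc k := B)) (Suc k) ** X) \<partial>\<mu>) \<partial>words k)"
    using meas unfolding * by (subst product_nn_integral_insert) auto
  also have "\<dots> = (\<integral>\<^sup>+A. left_average \<mu> f (left_prod A k ** X) \<partial>words k)"
    unfolding eq left_average_def by (simp add: matrix_mul_assoc)
  also have "\<dots> = (left_average \<mu> ^^ k) (left_average \<mu> f) X"
    by (rule Suc.IH) simp
  also have "\<dots> = (left_average \<mu> ^^ Suc k) f X" by (simp only: funpow_Suc_right comp_apply)
  finally show ?case .
qed

lemma AE_words: "AE A in words k. A \<in> {1..k} \<rightarrow> supp \<mu>"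
proof -
  have "AE A in words k. A i \<in> supp \<mu>" if "i \<in> {1..k}" for i
    using prob_space_axioms AE_supp[OF sets_borel] that by (intro AE_PiM_component) auto
  then have "AE A in words k. \<forall>i\<in>{1..k}. A i \<in> supp \<mu>" by (intro AE_finite_allI) auto
  then show ?thesis by (simp add: Pi_iff)
qed

section \<open>Moments of random products\<close>

definition sv_pow :: "nat \<Rightarrow> real^'n^'n \<Rightarrow> ennreal" where
  "sv_pow p X = ennreal (max_singular_value X ^ p)"

lemma borel_measurable_max_singular_value [measurable]:
  "(max_singular_value :: real^'n^'n \<Rightarrow> real) \<in> borel_measurable borel"
  by (intro borel_measurable_continuous_onI continuous_max_singular_value)

lemma borel_measurable_sv_pow [measurable]: "sv_pow p \<in> borel_measurable borel"
  unfolding sv_pow_def by measurable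

definition moment :: "nat \<Rightarrow> nat \<Rightarrow> real" where
  "moment p k = (\<integral>A. max_singular_value (left_prod A k) ^ p \<partial>words k)"

lemma moment_nonneg: "0 \<le> moment p k"
  unfolding moment_def by (intro integral_nonneg_AE AE_I2) (simp add: max_singular_value_nonneg)

text \<open>A crude bound, from factors that lie almost surely in the support; it serves to make the
  iterates finite.\<close>

lemma left_average_sv_pow_bound:
  assumes b: "0 \<le> b" "\<And>B. B \<in> supp \<mu> \<Longrightarrow> max_singular_value B \<le> b"
  shows "(left_average \<mu> ^^ k) (sv_pow p) X \<le> ennreal ((b ^ k * max_singular_value X) ^ p)"
proof (induction k arbitrary: X)
  case (Suc k)
  have "(left_average \<mu> ^^ Suc k) (sv_pow p) X \<le> (\<integral>\<^sup>+B. ennreal ((b ^ k * max_singular_value (B ** X)) ^ p) \<partial>\<mu>)"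
    by (simp add: left_average_def[of \<mu> "(left_average \<mu> ^^ k) (sv_pow p)"] nn_integral_mono Suc)
  also have "\<dots> \<le> (\<integral>\<^sup>+B. ennreal ((b ^ Suc k * max_singular_value X) ^ p) \<partial>\<mu>)"
  proof (rule nn_integral_mono_AE)
    have "ennreal ((b ^ k * max_singular_value (B ** X)) ^ p) \<le> ennreal ((b ^ Suc k * max_singular_value X) ^ p)"
      if "B \<in> supp \<mu>" for B
    proof -
      have "max_singular_value (B ** X) \<le> b * max_singular_value X"
        using max_singular_value_mult[of B X] mult_right_mono[OF b(2)[OF that] max_singular_value_nonneg[of X]]
        by linarith
      then have "b ^ k * max_singular_value (B ** X) \<le> b ^ Suc k * max_singular_value X"
        using mult_left_mono[of _ _ "b ^ k"] b(1) by (fastforce simp: mult_ac)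
      then show ?thesis using b(1) by (intro ennreal_leI power_mono) (simp_all add: max_singular_value_nonneg)
    qed
    then show "AE B in \<mu>. ennreal ((b ^ k * max_singular_value (B ** X)) ^ p)
        \<le> ennreal ((b ^ Suc k * max_singular_value X) ^ p)"
      using AE_supp[OF sets_borel] by (auto elim!: eventually_mono)
  qed
  also have "\<dots> = ennreal ((b ^ Suc k * max_singular_value X) ^ p)" by (simp add: emeasure_space_1)
  finally show ?case .
qed (simp add: sv_pow_def)

text \<open>Finiteness of the iterate is the point: it lets the real-valued integral carry the same
  value as the nonnegative one.\<close>

lemma ennreal_moment: "ennreal (moment p k) = (left_average \<mu> ^^ k) (sv_pow p) (mat 1)"
proof -
  obtain b where b: "0 \<le> b" "\<And>B. B \<in> supp \<mu> \<Longrightarrow> max_singular_value B \<le> b"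
    using supp_bound by blast
  have eq: "(\<integral>\<^sup>+A. ennreal (max_singular_value (left_prod A k) ^ p) \<partial>words k) = (left_average \<mu> ^^ k) (sv_pow p) (mat 1)"
    using nn_integral_left_prod[of "sv_pow p" k "mat 1"] by (simp add: sv_pow_def)
  have "moment p k = enn2real (\<integral>\<^sup>+A. ennreal (max_singular_value (left_prod A k) ^ p) \<partial>words k)"
    unfolding moment_def
  proof (rule integral_eq_nn_integral)
    show "(\<lambda>A. max_singular_value (left_prod A k) ^ p) \<in> borel_measurable (words k)"
      using measurable_left_prod_words[of k k] by measurable
  qed (simp add: max_singular_value_nonneg)
  moreover have "(left_average \<mu> ^^ k) (sv_pow p) (mat 1) < top"
    using left_average_sv_pow_bound[OF b] ennreal_less_top le_less_trans by blast
  ultimately show ?thesis unfolding eq by simp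
qed

text \<open>Submultiplicativity of the operator norm pulls \<open>X\<close> out of the
  expectation.\<close>

lemma left_average_sv_pow_le_moment:
  "(left_average \<mu> ^^ k) (sv_pow p) X \<le> ennreal (moment p k) * sv_pow p X"
proof -
  have m: "(\<lambda>A. sv_pow p (left_prod A k)) \<in> borel_measurable (words k)"
    using measurable_left_prod_words[of k k] by measurable
  have "sv_pow p (P ** X) \<le> sv_pow p P * sv_pow p X" for P
    using power_mono[OF max_singular_value_mult max_singular_value_nonneg, of P X p]
    by (simp add: sv_pow_def power_mult_distrib max_singular_value_nonneg ennreal_leI flip: ennreal_mult)
  then have "(\<integral>\<^sup>+A. sv_pow p (left_prod A k ** X) \<partial>words k) \<le> (\<integral>\<^sup>+A. sv_pow p (left_prod A k) * sv_pow p X \<partial>words k)"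
    by (intro nn_integral_mono)
  \<comment> \<open>The factor \<open>mat 1\<close> brings the integrand into the form of
    \<open>nn_integral_left_prod\<close>.\<close>
  also have "\<dots> = (\<integral>\<^sup>+A. sv_pow p (left_prod A k ** mat 1) \<partial>words k) * sv_pow p X"
    using m by (simp add: nn_integral_multc)
  finally show ?thesis by (simp only: nn_integral_left_prod borel_measurable_sv_pow ennreal_moment)
qed

text \<open>The first \<open>n\<close> and the last \<open>m\<close> factors are independent. The
  product of the first \<open>n\<close> takes the place of \<open>X\<close> in the preceding
  bound.\<close>

lemma moment_submultiplicative: "moment p (m + n) \<le> moment p m * moment p n"
proof -
  have m: "(\<lambda>A. sv_pow p (left_prod A n ** mat 1)) \<in> borel_measurable (words n)"
    using measurable_left_prod_words[of n n] by (simp; measurable)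
  have "ennreal (moment p (m + n)) = (left_average \<mu> ^^ n) ((left_average \<mu> ^^ m) (sv_pow p)) (mat 1)"
    by (simp add: ennreal_moment add.commute[of m n] funpow_add)
  also have "\<dots> = (\<integral>\<^sup>+A. (left_average \<mu> ^^ m) (sv_pow p) (left_prod A n ** mat 1) \<partial>words n)"
    by (subst nn_integral_left_prod) auto
  also have "\<dots> \<le> (\<integral>\<^sup>+A. ennreal (moment p m) * sv_pow p (left_prod A n ** mat 1) \<partial>words n)"
    by (intro nn_integral_mono left_average_sv_pow_le_moment)
  also have "\<dots> = ennreal (moment p m) * ennreal (moment p n)"
    using m by (simp add: nn_integral_cmult nn_integral_left_prod ennreal_moment del: matrix_mul_rid One_nat_def)
  finally show ?thesis using moment_nonneg by (simp flip: ennreal_mult)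
qed

text \<open>The \<open>lim\<close> in \<open>p_radius\<close> is informative only once convergence
  is known. Fekete's lemma for \<open>root p (moment p k)\<close> supplies it, since
  \<open>root (p * k)\<close> is an iterated root.\<close>

lemma p_radius_LIMSEQ:
  assumes p: "p \<ge> 1"
  shows "(\<lambda>k. root (p * k) (moment p k)) \<longlonglongrightarrow> p_radius p \<mu>"
proof -
  have "convergent (\<lambda>k. root k (root p (moment p k)))"
  proof (rule submultiplicative_root_convergent)
    show "0 \<le> root p (moment p n)" for n by (simp add: moment_nonneg real_root_ge_zero)
    show "root p (moment p (m + n)) \<le> root p (moment p m) * root p (moment p n)" for m n
      using p moment_submultiplicative by (simp flip: real_root_mult)
  qed
  then have "convergent (\<lambda>k. root (p * k) (moment p k))"
    by (simp add: mult.commute[of p] real_root_mult_exp)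
  then show ?thesis
    unfolding p_radius_def moment_def by (simp add: convergent_LIMSEQ_iff)
qed

lemma p_radius_nonneg:
  assumes "p \<ge> 1"
  shows "0 \<le> p_radius p \<mu>"
  by (rule LIMSEQ_le_const[OF p_radius_LIMSEQ[OF assms]]) (auto simp: moment_nonneg real_root_ge_zero)

text \<open>Almost surely the norm of a product of length \<open>k\<close> is at most the
  \<open>k\<close>-th power of the supremum, so the comparison holds for each
  \<open>k \<ge> 1\<close> before the limit.\<close>

lemma p_radius_le_joint_spectral_radius:
  assumes p: "p \<ge> 1"
  shows "ereal (p_radius p \<mu>) \<le> joint_spectral_radius (supp \<mu>)"
proof -
  let ?S = "\<lambda>k. SUP A \<in> {1..k} \<rightarrow> supp \<mu>. ereal (root k (max_singular_value (left_prod A k)))"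
  have "ereal (root (p * k) (moment p k)) \<le> ?S k" if k: "k \<ge> 1" for k
  proof (cases "?S k")
    \<comment> \<open>The supremum is an extended real: a nonempty support rules out minus infinity,
      and plus infinity is trivial.\<close>
    case (real s)
    have le: "root k (max_singular_value (left_prod A k)) \<le> s" if "A \<in> {1..k} \<rightarrow> supp \<mu>" for A
      using SUP_upper[OF that, of "\<lambda>A. ereal (root k (max_singular_value (left_prod A k)))"] real by simp
    obtain B where "B \<in> supp \<mu>" using supp_nonempty by blast
    then have "(\<lambda>_. B) \<in> {1..k} \<rightarrow> supp \<mu>" by simp
    from le[OF this] have s: "0 \<le> s" by (meson max_singular_value_nonneg order_trans real_root_ge_zero)
    have bound: "max_singular_value (left_prod A k) ^ p \<le> (s ^ k) ^ p" if "A \<in> {1..k} \<rightarrow> supp \<mu>" for A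
    proof -
      have "root k (max_singular_value (left_prod A k)) ^ k \<le> s ^ k"
        using le[OF that] by (intro power_mono) (auto simp: max_singular_value_nonneg real_root_ge_zero)
      then show ?thesis using k by (intro power_mono) (auto simp: max_singular_value_nonneg)
    qed
    interpret W: prob_space "words k" by (rule prob_space_PiM) (rule prob_space_axioms)
    have "ennreal (moment p k) = (\<integral>\<^sup>+A. ennreal (max_singular_value (left_prod A k) ^ p) \<partial>words k)"
      using nn_integral_left_prod[of "sv_pow p" k "mat 1"] by (simp add: ennreal_moment sv_pow_def)
    also have "\<dots> \<le> (\<integral>\<^sup>+A. ennreal ((s ^ k) ^ p) \<partial>words k)"
      using AE_words[of k] bound by (intro nn_integral_mono_AE) (auto elim!: eventually_mono intro: ennreal_leI)
    also have "\<dots> = ennreal ((s ^ k) ^ p)" by (simp add: W.emeasure_space_1 del: One_nat_def)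
    finally have "moment p k \<le> s ^ (p * k)" using s by (simp add: mult.commute[of p] power_mult)
    then have "root (p * k) (moment p k) \<le> root (p * k) (s ^ (p * k))" using p k by simp
    then show ?thesis using real s p k by (simp add: real_root_power_cancel)
  next
    case MInf
    obtain B where "B \<in> supp \<mu>" using supp_nonempty by blast
    then have "(\<lambda>_. B) \<in> {1..k} \<rightarrow> supp \<mu>" by simp
    from SUP_upper[OF this, of "\<lambda>A. ereal (root k (max_singular_value (left_prod A k)))"] MInf
    show ?thesis by simp
  qed simp
  then have "limsup (\<lambda>k. ereal (root (p * k) (moment p k))) \<le> limsup ?S"
    by (intro Limsup_mono eventually_sequentiallyI[of 1])
  moreover have "limsup (\<lambda>k. ereal (root (p * k) (moment p k))) = ereal (p_radius p \<mu>)"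
    using p_radius_LIMSEQ[OF p] by (intro lim_imp_Limsup) auto
  ultimately show ?thesis unfolding joint_spectral_radius_def by simp
qed

section \<open>Norms built from averaged powers\<close>

lemma left_average_scale:
  assumes [measurable]: "f \<in> borel_measurable borel" and hom: "\<And>c X. f (c *\<^sub>R X) = ennreal (\<bar>c\<bar> ^ p) * f X"
  shows "(left_average \<mu> ^^ k) f (c *\<^sub>R X) = ennreal (\<bar>c\<bar> ^ p) * (left_average \<mu> ^^ k) f X"
proof (induction k arbitrary: c X)
  case (Suc k)
  have "(left_average \<mu> ^^ Suc k) f (c *\<^sub>R X) = (\<integral>\<^sup>+B. ennreal (\<bar>c\<bar> ^ p) * (left_average \<mu> ^^ k) f (B ** X) \<partial>\<mu>)"
    by (simp add: left_average_def[of \<mu> "(left_average \<mu> ^^ k) f"] linear_cmul[OF linear_matrix_mul_left] Suc)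
  also have "\<dots> = ennreal (\<bar>c\<bar> ^ p) * left_average \<mu> ((left_average \<mu> ^^ k) f) X"
    by (simp add: nn_integral_cmult left_average_def[of \<mu> "(left_average \<mu> ^^ k) f"])
  finally show ?case by simp
qed (simp add: hom)

text \<open>Left multiplication is linear, so the inequality passes through the integral at every
  iteration.\<close>

lemma left_average_convex:
  assumes [measurable]: "f \<in> borel_measurable borel"
    and conv: "\<And>X Y. f (s *\<^sub>R X + t *\<^sub>R Y) \<le> ennreal s * f X + ennreal t * f Y"
  shows "(left_average \<mu> ^^ k) f (s *\<^sub>R X + t *\<^sub>R Y)
    \<le> ennreal s * (left_average \<mu> ^^ k) f X + ennreal t * (left_average \<mu> ^^ k) f Y"
proof (induction k arbitrary: X Y)
  case (Suc k)
  let ?g = "(left_average \<mu> ^^ k) f"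
  have "(left_average \<mu> ^^ Suc k) f (s *\<^sub>R X + t *\<^sub>R Y) = (\<integral>\<^sup>+B. ?g (s *\<^sub>R (B ** X) + t *\<^sub>R (B ** Y)) \<partial>\<mu>)"
    by (simp add: left_average_def[of \<mu> ?g] linear_cmul[OF linear_matrix_mul_left] linear_add[OF linear_matrix_mul_left])
  also have "\<dots> \<le> (\<integral>\<^sup>+B. ennreal s * ?g (B ** X) + ennreal t * ?g (B ** Y) \<partial>\<mu>)"
    by (intro nn_integral_mono Suc)
  also have "\<dots> = ennreal s * left_average \<mu> ?g X + ennreal t * left_average \<mu> ?g Y"
    by (simp add: nn_integral_add nn_integral_cmult left_average_def[of \<mu> ?g])
  finally show ?case by simp
qed (simp add: conv)

text \<open>For \<open>N ^ p\<close> take the series of the \<open>k\<close>-fold averages with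
  weights \<open>(1 / r ^ p) ^ k\<close>. Averaging once more shifts the index and yields
  \<open>r ^ p\<close> times the series without its first term.\<close>

lemma averaged_norm_exists:
  assumes p: "p \<ge> 1" and r: "p_radius p \<mu> < r"
  obtains N :: "real^'n^'n \<Rightarrow> real" where "seminorm_on UNIV N" "\<And>X. N X = 0 \<Longrightarrow> X = 0"
    "\<And>X. (\<integral>\<^sup>+B. ennreal (N (B ** X) ^ p) \<partial>\<mu>) \<le> ennreal (r ^ p * N X ^ p)"
proof -
  \<comment> \<open>Room below \<open>r\<close> gives the moment series a geometric majorant with
    ratio \<open>(r1 / r) ^ p < 1\<close>.\<close>
  obtain r1 where r1: "p_radius p \<mu> < r1" "r1 < r" using dense[OF r] by blast
  have pos: "0 < r1" "0 < r" using p_radius_nonneg[OF p] r1 by auto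
  define q where "q = 1 / r ^ p"
  have q: "0 < q" using pos by (simp add: q_def)
  define a where "a k = q ^ k * moment p k" for k
  have a0: "0 \<le> a k" for k using q moment_nonneg by (simp add: a_def)
  have "summable a"
  proof (rule summable_comparison_test_ev)
    show "summable (\<lambda>k. ((r1 / r) ^ p) ^ k)"
      using pos r1(2) p by (intro summable_geometric) (simp add: power_less_one_iff)
    have "\<forall>\<^sub>F k in sequentially. root (p * k) (moment p k) < r1"
      using p_radius_LIMSEQ[OF p] r1(1) by (rule order_tendstoD)
    then show "\<forall>\<^sub>F k in sequentially. norm (a k) \<le> ((r1 / r) ^ p) ^ k"
      using eventually_gt_at_top[of 0]
    proof eventually_elim
      case (elim k)
      have "root (p * k) (moment p k) ^ (p * k) \<le> r1 ^ (p * k)"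
        using elim(1) by (intro power_mono) (auto simp: moment_nonneg real_root_ge_zero)
      then have "moment p k \<le> r1 ^ (p * k)" using elim(2) p by (simp add: moment_nonneg)
      then have "a k \<le> q ^ k * r1 ^ (p * k)" using q by (simp add: a_def)
      also have "\<dots> = ((r1 / r) ^ p) ^ k" by (simp add: q_def power_divide power_mult)
      finally show ?case using a0 by simp
    qed
  qed
  define G where "G X = (\<Sum>k. ennreal (q ^ k) * (left_average \<mu> ^^ k) (sv_pow p) X)" for X
  have G_fin: "G X < top" for X
  proof -
    have "G X \<le> (\<Sum>k. ennreal (a k) * sv_pow p X)"
      unfolding G_def
    proof (intro suminf_le summableI)
      fix k show "ennreal (q ^ k) * (left_average \<mu> ^^ k) (sv_pow p) X \<le> ennreal (a k) * sv_pow p X"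
        using mult_left_mono[OF left_average_sv_pow_le_moment[of k p X], of "ennreal (q ^ k)"] q moment_nonneg
        by (simp add: a_def ennreal_mult mult.assoc)
    qed
    also have "\<dots> = ennreal (\<Sum>k. a k) * sv_pow p X"
      using suminf_ennreal2[OF a0 \<open>summable a\<close>] by simp
    also have "\<dots> < top" by (simp add: sv_pow_def ennreal_mult_less_top)
    finally show ?thesis .
  qed
  have G_scale: "G (c *\<^sub>R X) = ennreal (\<bar>c\<bar> ^ p) * G X" for c X
  proof -
    have "sv_pow p (c *\<^sub>R X) = ennreal (\<bar>c\<bar> ^ p) * sv_pow p X" for c and X :: "real^'n^'n"
      using seminorm_onD(3)[OF seminorm_max_singular_value, of X c]
      by (simp add: sv_pow_def power_mult_distrib max_singular_value_nonneg ennreal_mult)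
    note scale = left_average_scale[OF borel_measurable_sv_pow this]
    show ?thesis
      unfolding G_def scale by (subst ennreal_suminf_cmult[symmetric]) (simp only: mult.left_commute)
  qed
  have G_convex: "G (s *\<^sub>R X + t *\<^sub>R Y) \<le> ennreal s * G X + ennreal t * G Y"
    if st: "0 \<le> s" "0 \<le> t" "s + t = 1" for s t X Y
  proof -
    have "sv_pow p (s *\<^sub>R X + t *\<^sub>R Y) \<le> ennreal s * sv_pow p X + ennreal t * sv_pow p Y"
      for X Y :: "real^'n^'n"
    proof -
      have "max_singular_value (s *\<^sub>R X + t *\<^sub>R Y) \<le> s * max_singular_value X + t * max_singular_value Y"
        using seminorm_onD(2)[OF seminorm_max_singular_value, of "s *\<^sub>R X" "t *\<^sub>R Y"] st
          seminorm_onD(3)[OF seminorm_max_singular_value, of X s]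
          seminorm_onD(3)[OF seminorm_max_singular_value, of Y t] by simp
      then have "max_singular_value (s *\<^sub>R X + t *\<^sub>R Y) ^ p \<le> (s * max_singular_value X + t * max_singular_value Y) ^ p"
        by (intro power_mono max_singular_value_nonneg)
      also have "\<dots> \<le> s * max_singular_value X ^ p + t * max_singular_value Y ^ p"
        using st by (intro convex_power_combination max_singular_value_nonneg)
      finally show ?thesis
        using st by (simp add: sv_pow_def max_singular_value_nonneg ennreal_leI flip: ennreal_mult ennreal_plus)
    qed
    note conv = left_average_convex[OF borel_measurable_sv_pow this]
    have "G (s *\<^sub>R X + t *\<^sub>R Y) \<le> (\<Sum>k. ennreal s * (ennreal (q ^ k) * (left_average \<mu> ^^ k) (sv_pow p) X)
        + ennreal t * (ennreal (q ^ k) * (left_average \<mu> ^^ k) (sv_pow p) Y))"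
      unfolding G_def
    proof (intro suminf_le summableI)
      fix k
      show "ennreal (q ^ k) * (left_average \<mu> ^^ k) (sv_pow p) (s *\<^sub>R X + t *\<^sub>R Y)
        \<le> ennreal s * (ennreal (q ^ k) * (left_average \<mu> ^^ k) (sv_pow p) X)
        + ennreal t * (ennreal (q ^ k) * (left_average \<mu> ^^ k) (sv_pow p) Y)"
        using mult_left_mono[OF conv[of k X Y], of "ennreal (q ^ k)"]
        by (simp add: distrib_left mult.left_commute)
    qed
    then show ?thesis by (simp add: G_def suminf_add[symmetric] summableI)
  qed
  \<comment> \<open>The term at index 0 is \<open>sv_pow p X\<close> itself; it makes
    \<open>N\<close> definite.\<close>
  have G_ge: "sv_pow p X \<le> G X" for X
    using sum_le_suminf[OF summableI, of "{0}" "\<lambda>k. ennreal (q ^ k) * (left_average \<mu> ^^ k) (sv_pow p) X"]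
    by (simp add: G_def)
  have G_average: "(\<integral>\<^sup>+B. G (B ** X) \<partial>\<mu>) \<le> ennreal (r ^ p) * G X" for X
  proof -
    let ?f = "\<lambda>k. ennreal (q ^ k) * (left_average \<mu> ^^ k) (sv_pow p) X"
    have "(\<integral>\<^sup>+B. G (B ** X) \<partial>\<mu>) = (\<Sum>k. ennreal (q ^ k) * (left_average \<mu> ^^ Suc k) (sv_pow p) X)"
      by (simp add: G_def nn_integral_suminf nn_integral_cmult left_average_def[of \<mu> "(left_average \<mu> ^^ _) _"])
    also have "\<dots> = (\<Sum>k. ennreal (r ^ p) * ?f (Suc k))"
    proof -
      \<comment> \<open>One factor \<open>r ^ p\<close> restores the weight that belongs to the
        shifted index.\<close>
      have "q ^ k = r ^ p * q ^ Suc k" for k using pos by (simp add: q_def)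
      then have eq: "ennreal (q ^ k) = ennreal (r ^ p) * ennreal (q ^ Suc k)" for k
        using pos q by (subst ennreal_mult[symmetric]) auto
      have "ennreal (q ^ k) * (left_average \<mu> ^^ Suc k) (sv_pow p) X = ennreal (r ^ p) * ?f (Suc k)" for k
        by (simp only: eq[of k] mult.assoc)
      then show ?thesis by (rule suminf_cong)
    qed
    also have "\<dots> = ennreal (r ^ p) * (\<Sum>k. ?f (Suc k))" by simp
    also have "(\<Sum>k. ?f (Suc k)) \<le> G X"
      unfolding G_def using suminf_offset[of ?f 1] summableI[of ?f] by simp
    finally show ?thesis by (simp add: mult_left_mono)
  qed
  define g where "g X = enn2real (G X)" for X
  have g: "ennreal (g X) = G X" "0 \<le> g X" for X using G_fin[of X] by (auto simp: g_def)
  have g_def0: "X = 0" if "g X = 0" for X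
  proof -
    have "sv_pow p X = 0" using G_ge[of X] g(1)[of X] that by simp
    then have "max_singular_value X ^ p = 0" by (simp add: sv_pow_def max_singular_value_nonneg)
    then show ?thesis by (intro max_singular_value_eq_0) simp
  qed
  define N where "N X = root p (g X)" for X
  have Np: "N X ^ p = g X" for X using g(2) p by (simp add: N_def)
  show thesis
  proof (rule that[of N])
    show "seminorm_on UNIV N"
      unfolding N_def
    proof (rule seminorm_on_root[OF _ g(2)])
      show "g (c *\<^sub>R X) = \<bar>c\<bar> ^ p * g X" for c X
        unfolding g_def G_scale by (simp add: enn2real_mult)
      show "g (s *\<^sub>R X + t *\<^sub>R Y) \<le> s * g X + t * g Y" if "0 \<le> s" "0 \<le> t" "s + t = 1" for X Y s t
        using G_convex[OF that, of X Y] that g(2) by (simp flip: g(1) ennreal_mult ennreal_plus)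
    qed (use p g_def0 in auto)
    show "X = 0" if "N X = 0" for X using that g_def0[of X] p by (simp add: N_def)
    show "(\<integral>\<^sup>+B. ennreal (N (B ** X) ^ p) \<partial>\<mu>) \<le> ennreal (r ^ p * N X ^ p)" for X
      using G_average[of X] pos by (simp add: Np g(1) ennreal_mult g(2))
  qed
qed

subsection \<open>Contracting norms and the joint spectral radius\<close>

text \<open>Markov's inequality: if every support point \<open>B\<close> near \<open>A\<close>
  expanded \<open>X\<close> by at least \<open>r + e\<close>, the average over this neighbourhood
  alone would be too large for high exponents. The limit seminorm then absorbs the passage from
  \<open>B\<close> to \<open>A\<close>.\<close>

lemma invariant_seminorm_exists:
  fixes V :: "(real^'n^'n) set"
  assumes r: "0 < r" and freq: "\<exists>\<^sub>F p in sequentially. p_radius p \<mu> < r"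
    and V: "subspace V" "V \<noteq> {0}" and inv: "\<And>A X. A \<in> supp \<mu> \<Longrightarrow> X \<in> V \<Longrightarrow> A ** X \<in> V"
  obtains L where "seminorm_on V L" "\<exists>X\<in>V. L X \<noteq> 0"
    "\<And>A X. A \<in> supp \<mu> \<Longrightarrow> X \<in> V \<Longrightarrow> L (A ** X) \<le> r * L X"
proof -
  \<comment> \<open>Requiring \<open>Suc j \<le> p\<close> makes all exponents positive and forces
    them to infinity.\<close>
  have "\<forall>j. \<exists>p. Suc j \<le> p \<and> p_radius p \<mu> < r"
    using freq unfolding frequently_sequentially by blast
  then have "\<exists>P. \<forall>j. Suc j \<le> P j \<and> p_radius (P j) \<mu> < r" by (rule choice)
  then obtain P where P: "\<And>j. Suc j \<le> P j" "\<And>j. p_radius (P j) \<mu> < r" by blast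
  have P1: "1 \<le> P j" for j using P(1)[of j] by simp
  define Q :: "nat \<Rightarrow> (real^'n^'n \<Rightarrow> real) \<Rightarrow> bool" where
    "Q j N \<longleftrightarrow> seminorm_on UNIV N \<and> (\<forall>X. N X = 0 \<longrightarrow> X = 0) \<and>
      (\<forall>X. (\<integral>\<^sup>+B. ennreal (N (B ** X) ^ P j) \<partial>\<mu>) \<le> ennreal (r ^ P j * N X ^ P j))" for j N
  have "\<exists>N. Q j N" for j
    by (rule averaged_norm_exists[OF P1[of j] P(2)[of j]]) (auto simp: Q_def)
  then have "\<exists>N. \<forall>j. Q j (N j)" by (intro choice) blast
  then obtain N where Q: "\<And>j. Q j (N j)" by blast
  have N: "seminorm_on UNIV (N j)" "N j X = 0 \<Longrightarrow> X = 0"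
    and average: "(\<integral>\<^sup>+B. ennreal (N j (B ** X) ^ P j) \<partial>\<mu>) \<le> ennreal (r ^ P j * N j X ^ P j)" for j X
    using Q[of j] unfolding Q_def by blast+
  show thesis
  proof (rule limit_seminorm_exists[of V N r])
    show "subspace V" "V \<noteq> {0}" by fact+
    show "0 \<le> r" using r by simp
    show "seminorm_on V (N j)" for j by (rule seminorm_on_subset[OF N(1)]) simp
    show "X = 0" if "N j X = 0" for j X using that by (rule N(2))
    fix L assume L: "seminorm_on V L" "\<exists>X\<in>V. L X \<noteq> 0"
      and L_le: "\<And>X Z. X \<in> V \<Longrightarrow> Z \<in> V \<Longrightarrow>
        (\<And>e. 0 < e \<Longrightarrow> \<forall>\<^sub>F j in sequentially. \<exists>Y\<in>V. norm (Z - Y) \<le> e \<and> N j Y \<le> (r + e) * N j X) \<Longrightarrow>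
        L Z \<le> r * L X"
    show thesis
    proof (rule that[OF L])
      fix A X assume A: "A \<in> supp \<mu>" and X: "X \<in> V"
      show "L (A ** X) \<le> r * L X"
      proof (rule L_le[OF X inv[OF A X]])
        fix e :: real assume e: "0 < e"
        define U where "U = {B :: real^'n^'n. norm (A ** X - B ** X) < e}"
        have "continuous_on UNIV (\<lambda>B::real^'n^'n. fst (B, X) ** snd (B, X))"
          by (rule continuous_on_compose2[OF continuous_matrix_mul]) (auto intro!: continuous_intros)
        then have "open U"
          unfolding U_def by (intro open_Collect_less continuous_intros) simp
        moreover have "A \<in> U" using e by (simp add: U_def)
        ultimately have "0 < emeasure \<mu> U" using A by (auto simp: supp_def)
        then have m: "0 < prob U" by (simp add: emeasure_eq_measure)
        have U_sets: "U \<in> sets \<mu>" using \<open>open U\<close> by (simp add: sets_borel)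
        have gt1: "1 < (r + e) / r" using r e by simp
        \<comment> \<open>The mass of \<open>U\<close> is fixed while the exponents grow, so any
          ratio above 1 eventually overcomes \<open>1 / prob U\<close>.\<close>
        obtain n where n: "1 / prob U < ((r + e) / r) ^ n" using real_arch_pow[OF gt1] by blast
        have "\<forall>\<^sub>F j in sequentially. 1 / prob U < ((r + e) / r) ^ j"
          by (rule eventually_sequentiallyI[of n])
            (use n gt1 in \<open>auto intro: less_le_trans power_increasing\<close>)
        then show "\<forall>\<^sub>F j in sequentially. \<exists>Y\<in>V. norm (A ** X - Y) \<le> e \<and> N j Y \<le> (r + e) * N j X"
        proof eventually_elim
          case (elim j)
          have "((r + e) / r) ^ j \<le> ((r + e) / r) ^ P j"
            using P(1)[of j] r e by (intro power_increasing) auto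
          with elim have "1 / prob U < (r + e) ^ P j / r ^ P j" by (simp add: power_divide)
          then have large: "r ^ P j < prob U * (r + e) ^ P j" using m r by (simp add: field_simps)
          show ?case
          proof (cases "X = 0")
            \<comment> \<open>Kept apart because the contradiction below cancels a power of
              \<open>N j X\<close>, which must be positive.\<close>
            case True
            then show ?thesis using X e seminorm_on_0[OF N(1)] linear_0[OF linear_matrix_mul_left] by (intro bexI[of _ 0]) auto
          next
            case False
            then have NX: "0 < N j X" using N(2)[of j X] seminorm_onD(1)[OF N(1), of X j] by force
            show ?thesis
            proof (rule ccontr)
              assume H: "\<not> ?thesis"
              have big: "(r + e) * N j X \<le> N j (B ** X)" if "B \<in> supp \<mu>" "B \<in> U" for B
                using H that(2) inv[OF that(1) X] by (force simp: U_def)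
              have "ennreal (((r + e) * N j X) ^ P j) * emeasure \<mu> U =
                  (\<integral>\<^sup>+B. ennreal (((r + e) * N j X) ^ P j) * indicator U B \<partial>\<mu>)"
                using U_sets by (simp add: nn_integral_cmult_indicator)
              also have "\<dots> \<le> (\<integral>\<^sup>+B. ennreal (N j (B ** X) ^ P j) \<partial>\<mu>)"
              proof (rule nn_integral_mono_AE)
                show "AE B in \<mu>. ennreal (((r + e) * N j X) ^ P j) * indicator U B \<le> ennreal (N j (B ** X) ^ P j)"
                  using AE_supp[OF sets_borel]
                proof eventually_elim
                  case (elim B)
                  show ?case
                    using big[OF elim] r e NX by (cases "B \<in> U") (auto intro!: ennreal_leI power_mono)
                qed
              qed
              also have "\<dots> \<le> ennreal (r ^ P j * N j X ^ P j)" by (rule average)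
              finally have "((r + e) * N j X) ^ P j * prob U \<le> r ^ P j * N j X ^ P j"
                using r e NX by (simp add: emeasure_eq_measure flip: ennreal_mult)
              then have "(prob U * (r + e) ^ P j) * N j X ^ P j \<le> r ^ P j * N j X ^ P j"
                by (simp add: power_mult_distrib mult_ac)
              then show False using large NX by simp
            qed
          qed
        qed
      qed
    qed
  qed
qed

text \<open>The gluing induction is applied to left multiplications by support points, as linear
  maps of the matrix space.\<close>

lemma contracting_matrix_norm_exists:
  assumes r: "0 < r" and freq: "\<exists>\<^sub>F p in sequentially. p_radius p \<mu> < r" and s: "r < s"
  obtains N :: "real^'n^'n \<Rightarrow> real" where "seminorm_on UNIV N" "\<And>X. N X = 0 \<Longrightarrow> X = 0"
    "\<And>A X. A \<in> supp \<mu> \<Longrightarrow> N (A ** X) \<le> s * N X"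
proof -
  define F where "F = (\<lambda>A X::real^'n^'n. A ** X) ` supp \<mu>"
  obtain C where C: "0 \<le> C" "\<And>X::real^'n^'n. max_singular_value X \<le> C * norm X"
    using seminorm_on_bounded[OF seminorm_max_singular_value subspace_UNIV] by auto
  obtain c where c: "0 < c" "\<And>X::real^'n^'n. norm X \<le> c * max_singular_value X"
    using definite_seminorm_on_lower_bound[OF seminorm_max_singular_value subspace_UNIV]
      max_singular_value_eq_0 by auto
  obtain b where b: "0 \<le> b" "\<And>B. B \<in> supp \<mu> \<Longrightarrow> max_singular_value B \<le> b"
    using supp_bound by blast
  have lin: "linear f" if "f \<in> F" for f using that linear_matrix_mul_left by (auto simp: F_def)
  \<comment> \<open>\<open>c\<close> and \<open>C\<close> translate between the Frobenius norm and
    the operator norm, whose submultiplicativity gives the uniform bound.\<close>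
  have bdd: "norm (f X) \<le> c * (b * C) * norm X" if f: "f \<in> F" for f X
  proof -
    obtain A where A: "A \<in> supp \<mu>" "f = (\<lambda>X. A ** X)" using f by (auto simp: F_def)
    have "max_singular_value (A ** X) \<le> b * (C * norm X)"
      using max_singular_value_mult[of A X] mult_mono[OF b(2)[OF A(1)] C(2)[of X] b(1) max_singular_value_nonneg]
      by linarith
    then have "c * max_singular_value (A ** X) \<le> c * (b * (C * norm X))" using c(1) by simp
    then show ?thesis using c(2)[of "A ** X"] by (simp add: A(2) mult.assoc)
  qed
  have "\<exists>N :: real^'n^'n \<Rightarrow> real. seminorm_on UNIV N \<and> (\<forall>X\<in>UNIV. N X = 0 \<longrightarrow> X = 0) \<and> (\<forall>f\<in>F. \<forall>X\<in>UNIV. N (f X) \<le> s * N X)"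
  proof (rule contracting_norm_exists[where r = r and b = "c * (b * C)"])
    show "linear f" "norm (f X) \<le> c * (b * C) * norm X" if "f \<in> F" for f X
      using lin[OF that] bdd[OF that] by auto
    show "0 < r" "r < s" by fact+
    show "0 \<le> c * (b * C)" using c(1) b(1) C(1) by simp
    fix V :: "(real^'n^'n) set"
    assume V: "subspace V" and inv: "\<And>f. f \<in> F \<Longrightarrow> f ` V \<subseteq> V" and "V \<noteq> {0}"
    have "A ** X \<in> V" if "A \<in> supp \<mu>" "X \<in> V" for A X
      using inv[of "(**) A"] that by (auto simp: F_def)
    then obtain L where L: "seminorm_on V L" "\<exists>X\<in>V. L X \<noteq> 0"
      "\<And>A X. A \<in> supp \<mu> \<Longrightarrow> X \<in> V \<Longrightarrow> L (A ** X) \<le> r * L X"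
      by (rule invariant_seminorm_exists[OF r freq V \<open>V \<noteq> {0}\<close>]) auto
    then show "\<exists>N. seminorm_on V N \<and> (\<exists>X\<in>V. N X \<noteq> 0) \<and> (\<forall>f\<in>F. \<forall>X\<in>V. N (f X) \<le> r * N X)"
      by (intro exI[of _ L]) (auto simp: F_def)
  qed auto
  then obtain N where "seminorm_on UNIV N" "\<And>X. N X = 0 \<Longrightarrow> X = 0" "\<And>f X. f \<in> F \<Longrightarrow> N (f X) \<le> s * N X"
    by blast
  then show thesis by (intro that[of N]) (auto simp: F_def)
qed

text \<open>In a norm contracted by \<open>s\<close> all products of length \<open>k\<close> are at
  most \<open>D * s ^ k\<close>, and \<open>root k D\<close> tends to 1; then \<open>s\<close>
  decreases to \<open>r\<close>. Infinitely many \<open>p\<close> suffice, which is what negating an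
  eventual lower bound provides.\<close>

lemma joint_spectral_radius_le:
  assumes r: "0 < r" and freq: "\<exists>\<^sub>F p in sequentially. p_radius p \<mu> < r"
  shows "joint_spectral_radius (supp \<mu>) \<le> ereal r"
proof (rule ereal_le_epsilon2)
  fix e :: real assume e: "0 < e"
  define s where "s = r + e"
  have s: "r < s" "0 < s" using r e by (auto simp: s_def)
  obtain N :: "real^'n^'n \<Rightarrow> real" where N: "seminorm_on UNIV N" "\<And>X. N X = 0 \<Longrightarrow> X = 0"
    "\<And>A X. A \<in> supp \<mu> \<Longrightarrow> N (A ** X) \<le> s * N X"
    using contracting_matrix_norm_exists[OF r freq s(1)] by blast
  obtain C where C: "0 \<le> C" "\<And>X::real^'n^'n. max_singular_value X \<le> C * norm X"
    using seminorm_on_bounded[OF seminorm_max_singular_value subspace_UNIV] by auto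
  obtain c where c: "0 < c" "\<And>X. norm X \<le> c * N X"
    using definite_seminorm_on_lower_bound[OF N(1) subspace_UNIV N(2)] by auto
  \<comment> \<open>The 1 makes \<open>D\<close> positive, as the limit of its roots requires;
    \<open>C\<close> is only known to be nonnegative.\<close>
  define D where "D = C * (c * N (mat 1)) + 1"
  have N0: "0 \<le> N (mat 1)" using seminorm_onD(1)[OF N(1)] by simp
  have D: "0 < D" using C(1) c(1) N0 by (simp add: D_def add_nonneg_pos)
  have prod_N: "N (left_prod A k) \<le> s ^ k * N (mat 1)" if "A \<in> {1..k} \<rightarrow> supp \<mu>" for A k
    using that
  proof (induction k)
    case (Suc k)
    have "A \<in> {1..k} \<rightarrow> supp \<mu>" "A (Suc k) \<in> supp \<mu>" using Suc.prems by auto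
    have "N (A (Suc k) ** left_prod A k) \<le> s * N (left_prod A k)" by (rule N(3)) fact
    also have "\<dots> \<le> s * (s ^ k * N (mat 1))" using Suc.IH[OF \<open>A \<in> {1..k} \<rightarrow> supp \<mu>\<close>] s(2) by simp
    finally show ?case by (simp add: mult.assoc)
  qed simp
  have prod_le: "max_singular_value (left_prod A k) \<le> D * s ^ k" if A: "A \<in> {1..k} \<rightarrow> supp \<mu>" for A k
  proof -
    have "max_singular_value (left_prod A k) \<le> C * (c * (s ^ k * N (mat 1)))"
      by (rule order_trans[OF C(2)], intro mult_left_mono[OF _ C(1)] order_trans[OF c(2)]
          mult_left_mono[OF prod_N[OF A]]) (use c(1) in simp)
    also have "\<dots> \<le> D * s ^ k" using s(2) by (simp add: D_def algebra_simps)
    finally show ?thesis .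
  qed
  have "joint_spectral_radius (supp \<mu>) \<le> limsup (\<lambda>k. ereal (root k D * s))"
    unfolding joint_spectral_radius_def
  proof (intro Limsup_mono eventually_sequentiallyI[of 1] SUP_least)
    fix k :: nat and A assume k: "1 \<le> k" and A: "A \<in> {1..k} \<rightarrow> supp \<mu>"
    have "root k (max_singular_value (left_prod A k)) \<le> root k (D * s ^ k)" using prod_le[OF A] k by simp
    also have "\<dots> = root k D * s" using s(2) k by (simp add: real_root_mult real_root_power_cancel)
    finally show "ereal (root k (max_singular_value (left_prod A k))) \<le> ereal (root k D * s)" by simp
  qed
  also have "\<dots> = ereal s"
  proof -
    have "(\<lambda>k. root k D * s) \<longlonglongrightarrow> 1 * s" using D by (intro tendsto_intros LIMSEQ_root_const)
    then show ?thesis by (intro lim_imp_Limsup) auto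
  qed
  finally show "joint_spectral_radius (supp \<mu>) \<le> ereal r + ereal e" by (simp add: s_def)
qed

text \<open>The upper estimate holds for each \<open>p \<ge> 1\<close>. If the lower one failed at
  \<open>a\<close>, infinitely many p-radii would be at most \<open>a\<close>, hence below any real
  \<open>b\<close> above \<open>a\<close>; choosing \<open>b\<close> below the joint spectral radius
  gives a contradiction.\<close>

lemma p_radius_tendsto_joint_spectral_radius:
  "(\<lambda>p. ereal (p_radius p \<mu>)) \<longlonglongrightarrow> joint_spectral_radius (supp \<mu>)"
proof (rule order_tendstoI)
  fix a assume a: "a < joint_spectral_radius (supp \<mu>)"
  show "\<forall>\<^sub>F p in sequentially. a < ereal (p_radius p \<mu>)"
  proof (rule ccontr)
    assume "\<not> ?thesis"
    then have freq: "\<exists>\<^sub>F p in sequentially. ereal (p_radius p \<mu>) \<le> a"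
      by (simp add: not_eventually not_less)
    obtain b where b: "a < ereal b" "ereal b < joint_spectral_radius (supp \<mu>)"
      using ereal_dense2[OF a] by blast
    have freq_b: "\<exists>\<^sub>F p in sequentially. p_radius p \<mu> < b"
      using freq by (rule frequently_elim1) (use b(1) in \<open>auto dest: le_less_trans\<close>)
    \<comment> \<open>One exponent \<open>p \<ge> 1\<close> is singled out to obtain
      \<open>0 < b\<close> from the nonnegativity of its p-radius.\<close>
    have "\<exists>\<^sub>F p in sequentially. p_radius p \<mu> < b \<and> 1 \<le> p"
      using freq_b eventually_ge_at_top[of 1] by (rule frequently_eventually_frequently)
    then obtain p where p: "1 \<le> p" "p_radius p \<mu> < b" using frequently_ex by blast
    then have "joint_spectral_radius (supp \<mu>) \<le> ereal b"
      using p_radius_nonneg[OF p(1)] freq_b by (intro joint_spectral_radius_le) auto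
    then show False using b(2) by simp
  qed
next
  fix a assume "joint_spectral_radius (supp \<mu>) < a"
  then show "\<forall>\<^sub>F p in sequentially. ereal (p_radius p \<mu>) < a"
    using p_radius_le_joint_spectral_radius by (intro eventually_sequentiallyI[of 1]) (rule le_less_trans)
qed

end

theorem theorem4p1:
  fixes \<mu> \<mu>\<^sub>s :: "(real^'n^'n) measure"
    and K :: "(real^'n) set"
  assumes "prob_space \<mu>" and "sets \<mu> = sets borel"
    and "bounded (supp \<mu>)"
    and "proper_cone K" and "\<And>A. A \<in> supp \<mu> \<Longrightarrow> (*v) A ` K \<subseteq> K"
    and "is_singular_part lborel \<mu> \<mu>\<^sub>s"
    and "\<mu>\<^sub>s = null_measure borel \<or>
         (\<exists>(N::nat) (w :: nat \<Rightarrow> real) (M :: nat \<Rightarrow> real^'n^'n).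
            (\<forall>i\<in>{1..N}. w i > 0) \<and>
            (\<forall>B\<in>sets borel. emeasure \<mu>\<^sub>s B =
               (\<Sum>i=1..N. ennreal (w i) * emeasure (return borel (M i)) B)))"
  shows "(\<lambda>p. ereal (p_radius p \<mu>)) \<longlonglongrightarrow> joint_spectral_radius (supp \<mu>)"
proof -
  interpret bounded_matrix_law \<mu>
    using assms(1-3) by (simp add: bounded_matrix_law_def bounded_matrix_law_axioms_def)
  show ?thesis by (rule p_radius_tendsto_joint_spectral_radius)
qed

end
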